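(* Let $k\ge2$, $m\ge0$, $1\le s\le k$, and $N=mk+s$. For vincular patterns of length three in which exactly the last two letters are required to be adjacent, the numbers of avoiding permutations in $\mathcal{D}_{mk+s,k}$ are as follows. (1) $|\mathcal{D}_{N,k}(1\underline{23})|=0$ if $k\ge3$ and $N\ge3$; otherwise $|\mathcal{D}_{N,k}(1\underline{23})|=\operatorname{LE}(P^{123}_{m,s,k})$, where $P^{123}_{m,s,k}$ is the poset obtained from the block poset $B_{m,s,k}$ by adding, for every adjacent ascent pair $x_{i,a}<x_{i,a+1}$ (two consecutive positions of the same block), the relations $x_{i,a}<y$ for every position $y$ earlier than $x_{i,a}$. (2) $|\mathcal{D}_{N,k}(1\underline{32})|=\frac{1}{m!}\prod_{j=1}^{m}\binom{s+jk-1}{k}$. (3) $|\mathcal{D}_{N,k}(2\underline{13})|=\frac{1}{(k-1)(m+1)+1}\binom{k(m+1)}{m+1}$. (4) $|\mathcal{D}_{N,k}(2\underline{31})|=\frac{s}{mk+s}\binom{mk+s}{m}$. (5) $|\mathcal{D}_{N,k}(3\underline{12})|=k^m\,m!$. (6) $|\mathcal{D}_{N,k}(3\underline{21})|=\operatorname{LE}(P^{321\prime}_{m,s,k})$, where $P^{321\prime}_{m,s,k}$ is the poset obtained from $B_{m,s,k}$ by adding, for every boundary descent $x_{i,k}>x_{i+1,1}$ ($1\le i\le m$), the relations $y<x_{i,k}$ for every position $y$ earlier than $x_{i,k}$.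
   Context: For $\pi=\pi_1\cdots\pi_N\in S_N$ let $\operatorname{Des}(\pi)=\{i\in[N-1]:\pi_i>\pi_{i+1}\}$. For $k\ge2$, $N\ge1$, let $\mathcal{D}_{N,k}=\{\pi\in S_N:\operatorname{Des}(\pi)=\{k,2k,\ldots,k\lfloor (N-1)/k\rfloor\}\}$. For $abc\in S_3$, $\pi$ contains the vincular pattern $a\underline{bc}$ if there are positions $i<j<j+1$ such that $\pi_i\pi_j\pi_{j+1}$ has the same relative order as $abc$; otherwise it avoids it. $\mathcal{D}_{N,k}(p)$ is the set of elements of $\mathcal{D}_{N,k}$ avoiding $p$. Empty products equal $1$. Write $N=mk+s$ with $1\le s\le k$, and split the positions $1,\ldots,N$ from left to right into $m$ blocks of length $k$ followed by a last block of length $s$; $x_{i,a}$ is the $a$-th position of the $i$-th block ($1\le a\le k$ for $i\le m$, $1\le a\le s$ for $i=m+1$). The block poset $B_{m,s,k}$ on the elements $x_{i,a}$ is generated by $x_{i,a}<x_{i,a+1}$ inside each block and $x_{i+1,1}<x_{i,k}$ for $1\le i\le m$. "Adding relations" to a poset means taking the transitive closure. "Left/right/earlier" refer to the order of positions $1,\ldots,N$. $\operatorname{LE}(P)$ is the number of linear extensions of a finite poset $P$. *)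

theory Defs
  imports Complex_Main "HOL-Combinatorics.Permutations"
begin

section \<open>Permutations with prescribed descents, and vincular patterns\<close>

definition Des :: "nat \<Rightarrow> (nat \<Rightarrow> nat) \<Rightarrow> nat set" where
  "Des N \<pi> = {i \<in> {1..N - 1}. \<pi> i > \<pi> (i + 1)}"

definition descent_class :: "nat \<Rightarrow> nat \<Rightarrow> (nat \<Rightarrow> nat) set" where
  "descent_class N k = {\<pi>. \<pi> permutes {1..N} \<and> Des N \<pi> = {k * j | j. j \<in> {1..(N - 1) div k}}}"

definition same_relative_order :: "nat list \<Rightarrow> nat list \<Rightarrow> bool" where
  "same_relative_order us vs \<longleftrightarrow> length us = length vs \<and>
     (\<forall>i < length us. \<forall>j < length us. us ! i < us ! j \<longleftrightarrow> vs ! i < vs ! j)"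

text \<open>The last two letters of the pattern \<open>[a, b, c]\<close> have to occupy adjacent positions.\<close>

definition contains_vincular :: "nat \<Rightarrow> (nat \<Rightarrow> nat) \<Rightarrow> nat list \<Rightarrow> bool" where
  "contains_vincular N \<pi> p \<longleftrightarrow>
     (\<exists>i j. 1 \<le> i \<and> i < j \<and> j + 1 \<le> N \<and> same_relative_order [\<pi> i, \<pi> j, \<pi> (j + 1)] p)"

definition avoiders :: "nat \<Rightarrow> nat \<Rightarrow> nat list \<Rightarrow> (nat \<Rightarrow> nat) set" where
  "avoiders N k p = {\<pi> \<in> descent_class N k. \<not> contains_vincular N \<pi> p}"


section \<open>Block posets\<close>

text \<open>
  The ground set consists of the positions \<open>{1..m * k + s}\<close> themselves, so that "earlier" is
  the order of the natural numbers.  A partial order is a set of pairs \<open>(x, y)\<close> meaning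
  \<open>x \<le> y\<close>, reflexive on the ground set.
\<close>

definition block_length :: "nat \<Rightarrow> nat \<Rightarrow> nat \<Rightarrow> nat \<Rightarrow> nat" where
  "block_length m s k i = (if i \<le> m then k else s)"

definition block_pos :: "nat \<Rightarrow> nat \<Rightarrow> nat \<Rightarrow> nat" where
  "block_pos k i a = (i - 1) * k + a"

definition add_relations :: "nat rel \<Rightarrow> nat rel \<Rightarrow> nat rel" where
  "add_relations P R = (P \<union> R)\<^sup>+"

text \<open>The index pairs \<open>(i, a)\<close> of the positions that have a right neighbour in their block.\<close>

definition ascent_indices :: "nat \<Rightarrow> nat \<Rightarrow> nat \<Rightarrow> (nat \<times> nat) set" where
  "ascent_indices m s k = {(i, a). i \<in> {1..m + 1} \<and> 1 \<le> a \<and> a + 1 \<le> block_length m s k i}"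

definition block_poset :: "nat \<Rightarrow> nat \<Rightarrow> nat \<Rightarrow> nat rel" where
  "block_poset m s k = add_relations (Id_on {1..m * k + s})
     ({(block_pos k i a, block_pos k i (a + 1)) | i a. (i, a) \<in> ascent_indices m s k} \<union>
      {(block_pos k (i + 1) 1, block_pos k i k) | i. i \<in> {1..m}})"

definition poset_123 :: "nat \<Rightarrow> nat \<Rightarrow> nat \<Rightarrow> nat rel" where
  "poset_123 m s k = add_relations (block_poset m s k)
     {(block_pos k i a, y) | i a y. (i, a) \<in> ascent_indices m s k \<and> y \<in> {1..<block_pos k i a}}"

definition poset_321 :: "nat \<Rightarrow> nat \<Rightarrow> nat \<Rightarrow> nat rel" where
  "poset_321 m s k = add_relations (block_poset m s k)
     {(y, block_pos k i k) | i y. i \<in> {1..m} \<and> y \<in> {1..<block_pos k i k}}"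

text \<open>The number of linear extensions of the partial order \<open>P\<close> on the finite set \<open>A\<close>.\<close>

definition LE :: "nat set \<Rightarrow> nat rel \<Rightarrow> nat" where
  "LE A P = card {L. linear_order_on A L \<and> P \<subseteq> L}"


section \<open>The relations above are partial orders\<close>

lemma trancl_rank_le:
  fixes f :: "nat \<Rightarrow> nat"
  assumes "(x, y) \<in> G\<^sup>+" and "\<And>x y. (x, y) \<in> G \<Longrightarrow> x = y \<or> f x < f y"
  shows "x = y \<or> f x < f y"
  using assms(1) by induction (use assms(2) in \<open>force+\<close>)

lemma partial_order_trancl:
  fixes f :: "nat \<Rightarrow> nat"
  assumes "G \<subseteq> A \<times> A" and "Id_on A \<subseteq> G"
    and "\<And>x y. (x, y) \<in> G \<Longrightarrow> x = y \<or> f x < f y"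
  shows "partial_order_on A (G\<^sup>+)"
proof -
  have "G\<^sup>+ \<subseteq> A \<times> A"
    using assms(1) by (rule trancl_subset_Sigma)
  moreover have "refl_on A (G\<^sup>+)"
    using assms(2) by (auto simp: refl_on_def Id_on_def)
  moreover have "antisym (G\<^sup>+)"
  proof (rule antisymI)
    fix x y assume "(x, y) \<in> G\<^sup>+" "(y, x) \<in> G\<^sup>+"
    then have "x = y \<or> f x < f y" "y = x \<or> f y < f x"
      using trancl_rank_le[of _ _ G f] assms(3) by blast+
    then show "x = y" by auto
  qed
  ultimately show ?thesis
    by (simp add: partial_order_on_def preorder_on_def)
qed

lemma block_pos_mem:
  assumes "1 \<le> i" "i \<le> m + 1" "1 \<le> a" "a \<le> block_length m s k i"
  shows "block_pos k i a \<in> {1..m * k + s}"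
proof (cases "i \<le> m")
  case True
  have "(i - 1) * k + k = i * k"
    using assms(1) by (cases i) auto
  moreover have "i * k \<le> m * k"
    using True by simp
  ultimately have "(i - 1) * k + k \<le> m * k" by simp
  moreover have "a \<le> k" using True assms(4) by (simp add: block_length_def)
  ultimately show ?thesis
    using assms(3) unfolding block_pos_def by auto
next
  case False
  then have "i = m + 1" using assms(2) by simp
  then show ?thesis
    using assms unfolding block_pos_def block_length_def by auto
qed

lemma block_pos_div_mod:
  assumes "1 \<le> a" "a \<le> k"
  shows "(block_pos k i a - 1) div k = i - 1" and "(block_pos k i a - 1) mod k = a - 1"
proof -
  have "block_pos k i a - 1 = (i - 1) * k + (a - 1)"
    using assms by (simp add: block_pos_def)
  moreover have "a - 1 < k" using assms by simp
  ultimately show "(block_pos k i a - 1) div k = i - 1" "(block_pos k i a - 1) mod k = a - 1"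
    by auto
qed

lemma ascent_indicesD:
  assumes "(i, a) \<in> ascent_indices m s k" "s \<le> k"
  shows "1 \<le> i" "i \<le> m + 1" "1 \<le> a" "a + 1 \<le> k"
    "block_pos k i a \<in> {1..m * k + s}" "block_pos k i (a + 1) \<in> {1..m * k + s}"
proof -
  show *: "1 \<le> i" "i \<le> m + 1" "1 \<le> a" "a + 1 \<le> k"
    using assms by (auto simp: ascent_indices_def block_length_def split: if_splits)
  show "block_pos k i a \<in> {1..m * k + s}" "block_pos k i (a + 1) \<in> {1..m * k + s}"
    using * assms(1) by (intro block_pos_mem; simp add: ascent_indices_def)+
qed

lemma block_boundary_mem:
  assumes "i \<in> {1..m}" "1 \<le> s" "s \<le> k"
  shows "block_pos k (i + 1) 1 \<in> {1..m * k + s}" "block_pos k i k \<in> {1..m * k + s}"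
  using assms by (intro block_pos_mem; simp add: block_length_def)+

lemma block_poset_subset:
  assumes "1 \<le> s" "s \<le> k"
  shows "block_poset m s k \<subseteq> {1..m * k + s} \<times> {1..m * k + s}"
  unfolding block_poset_def add_relations_def
  using assms by (intro trancl_subset_Sigma) (blast dest: ascent_indicesD(5,6) block_boundary_mem)

lemma Id_on_block_poset: "Id_on {1..m * k + s} \<subseteq> block_poset m s k"
  by (auto simp: block_poset_def add_relations_def)

lemma block_poset_rank:
  fixes f :: "nat \<Rightarrow> nat"
  assumes "(x, y) \<in> block_poset m s k"
    and "\<And>i a. (i, a) \<in> ascent_indices m s k \<Longrightarrow> f (block_pos k i a) < f (block_pos k i (a + 1))"
    and "\<And>i. i \<in> {1..m} \<Longrightarrow> f (block_pos k (i + 1) 1) < f (block_pos k i k)"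
  shows "x = y \<or> f x < f y"
  using assms(1) unfolding block_poset_def add_relations_def
  by (rule trancl_rank_le) (use assms(2,3) in blast)

definition block_rank :: "nat \<Rightarrow> nat \<Rightarrow> nat \<Rightarrow> nat" where
  "block_rank m k p = (m - (p - 1) div k) * k + (p - 1) mod k"

lemma block_rank_block_pos:
  "1 \<le> a \<Longrightarrow> a \<le> k \<Longrightarrow> block_rank m k (block_pos k i a) = (m - (i - 1)) * k + (a - 1)"
  by (simp only: block_rank_def block_pos_div_mod)

lemma block_poset_block_rank:
  assumes "2 \<le> k" "s \<le> k" "(x, y) \<in> block_poset m s k"
  shows "x = y \<or> block_rank m k x < block_rank m k y"
  using assms(3)
proof (rule block_poset_rank)
  fix i a assume "(i, a) \<in> ascent_indices m s k"
  then show "block_rank m k (block_pos k i a) < block_rank m k (block_pos k i (a + 1))"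
    using ascent_indicesD(3,4)[of i a m s k] assms(2) by (simp add: block_rank_block_pos)
next
  fix i assume i: "i \<in> {1..m}"
  have "(m - (i + 1 - 1)) * k \<le> (m - (i - 1)) * k"
    by (intro mult_le_mono1) simp
  then show "block_rank m k (block_pos k (i + 1) 1) < block_rank m k (block_pos k i k)"
    using assms(1) block_rank_block_pos[of 1 k m "i + 1"] block_rank_block_pos[of k k m i]
    by linarith
qed

theorem block_poset_partial_order:
  assumes "2 \<le> k" "1 \<le> s" "s \<le> k"
  shows "partial_order_on {1..m * k + s} (block_poset m s k)"
proof -
  have "partial_order_on {1..m * k + s} ((block_poset m s k)\<^sup>+)"
    using block_poset_subset[of s k m] Id_on_block_poset[of m k s] block_poset_block_rank[of k s _ _ m] assms
    by (intro partial_order_trancl[where f = "block_rank m k"]) auto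
  then show ?thesis
    by (simp add: block_poset_def add_relations_def)
qed

theorem poset_123_partial_order:
  assumes "2 \<le> k" "1 \<le> s" "s \<le> k" and small: "\<not> (k \<ge> 3 \<and> m * k + s \<ge> 3)"
  shows "partial_order_on {1..m * k + s} (poset_123 m s k)"
  unfolding poset_123_def add_relations_def
proof (rule partial_order_trancl[where f = "block_rank m k"])
  let ?A = "{1..m * k + s}"
  let ?R = "{(block_pos k i a, y) | i a y. (i, a) \<in> ascent_indices m s k \<and> y \<in> {1..<block_pos k i a}}"
  have "?R \<subseteq> ?A \<times> ?A"
    using ascent_indicesD(5)[of _ _ m s k] assms(3) by fastforce
  then show "block_poset m s k \<union> ?R \<subseteq> ?A \<times> ?A"
    using block_poset_subset[of s k m] assms by auto
  show "Id_on ?A \<subseteq> block_poset m s k \<union> ?R"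
    using Id_on_block_poset[of m k s] by blast
  fix x y assume "(x, y) \<in> block_poset m s k \<union> ?R"
  then show "x = y \<or> block_rank m k x < block_rank m k y"
  proof
    assume "(x, y) \<in> block_poset m s k"
    then show ?thesis using block_poset_block_rank assms by blast
  next
    assume "(x, y) \<in> ?R"
    then obtain i a where ia: "(i, a) \<in> ascent_indices m s k" and x: "x = block_pos k i a"
      and y: "1 \<le> y" "y < block_pos k i a" by auto
    note D = ascent_indicesD[OF ia assms(3)]
    have a: "a = 1"
    proof (cases "k = 2")
      case True
      then show ?thesis using D by simp
    next
      case False
      then have "m * k + s \<le> 2" using small assms(1) by simp
      then have "m * k \<le> 1" using assms(2) by simp
      then have "m = 0" using assms(1) by (cases m) auto
      then show ?thesis
        using \<open>m * k + s \<le> 2\<close> ia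
        by (auto simp: ascent_indices_def block_length_def)
    qed
    then have "y - 1 < (i - 1) * k"
      using y by (simp add: block_pos_def)
    then have "(y - 1) div k < i - 1"
      by (rule less_mult_imp_div_less)
    then have "m - (i - 1) < m - (y - 1) div k"
      using D(2) by linarith
    then have "(m - (i - 1)) * k < (m - (y - 1) div k) * k"
      using assms(1) by simp
    then have "(m - (i - 1)) * k < block_rank m k y"
      unfolding block_rank_def by linarith
    moreover have "block_rank m k x = (m - (i - 1)) * k"
      using x a assms(1) by (simp add: block_rank_block_pos)
    ultimately show ?thesis by simp
  qed
qed

theorem poset_321_partial_order:
  assumes "2 \<le> k" "1 \<le> s" "s \<le> k"
  shows "partial_order_on {1..m * k + s} (poset_321 m s k)"
proof -
  let ?A = "{1..m * k + s}"
  let ?R = "{(y, block_pos k i k) | i y. i \<in> {1..m} \<and> y \<in> {1..<block_pos k i k}}"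
  define f where "f p = (if (p - 1) mod k = k - 1 \<and> (p - 1) div k < m
    then k + p else (p - 1) mod k)" for p
  have f_pos: "f (block_pos k i a) =
      (if a = k \<and> i - 1 < m then k + block_pos k i a else a - 1)" if "1 \<le> a" "a \<le> k" for i a
    unfolding f_def block_pos_div_mod[OF that] using that by auto
  have f_le: "f p \<le> k + p" for p
  proof -
    have "(p - 1) mod k < k" using assms(1) by simp
    then show ?thesis unfolding f_def by (split if_split, intro conjI impI) linarith+
  qed
  have f_top: "f (block_pos k i k) = k + block_pos k i k" if "i \<in> {1..m}" for i
    using f_pos[of k i] that assms(1) by auto
  have block: "x = y \<or> f x < f y" if "(x, y) \<in> block_poset m s k" for x y
    using that
  proof (rule block_poset_rank)
    fix i a assume "(i, a) \<in> ascent_indices m s k"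
    then show "f (block_pos k i a) < f (block_pos k i (a + 1))"
      using ascent_indicesD(3,4)[of i a m s k] assms(3) f_pos[of a i] f_pos[of "a + 1" i]
      by (auto split: if_splits)
  next
    fix i assume "i \<in> {1..m}"
    then show "f (block_pos k (i + 1) 1) < f (block_pos k i k)"
      using f_pos[of 1 "i + 1"] f_top[of i] assms(1) by simp
  qed
  have extra: "f x < f y" if R: "(x, y) \<in> ?R" for x y
  proof -
    obtain i where "i \<in> {1..m}" "y = block_pos k i k" "x < y" using R by auto
    then show ?thesis using f_top[of i] f_le[of x] by simp
  qed
  have "?R \<subseteq> ?A \<times> ?A"
    using block_boundary_mem(2)[of _ m s k] assms(2,3) by fastforce
  then have "block_poset m s k \<union> ?R \<subseteq> ?A \<times> ?A"
    using block_poset_subset[of s k m] assms by auto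
  moreover have "Id_on ?A \<subseteq> block_poset m s k \<union> ?R"
    using Id_on_block_poset[of m k s] by blast
  ultimately show ?thesis
    unfolding poset_321_def add_relations_def
    by (rule partial_order_trancl[where f = f]) (use block extra in blast)
qed

end

theory Submission
  imports Defs "HOL-Library.FuncSet"
begin

text \<open>
  Let \<open>e\<^sub>j\<close> be the number of \<open>i \<le> j\<close> with \<open>\<pi> i < \<pi> j\<close>; this code identifies the permutations of
  \<open>{1..N}\<close> with the sequences satisfying \<open>0 \<le> e\<^sub>j < j\<close>.  There is a descent at \<open>j\<close> iff
  \<open>e\<^sub>j\<^sub>+\<^sub>1 \<le> e\<^sub>j\<close>.  As the last two letters of a pattern are adjacent, avoidance is also a local
  condition on the code: 132 demands \<open>e\<^sub>j\<^sub>+\<^sub>1 = 0\<close> and 231 demands \<open>e\<^sub>j\<^sub>+\<^sub>1 = e\<^sub>j\<close> at every descent, 213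
  demands \<open>e\<^sub>j\<^sub>+\<^sub>1 = e\<^sub>j + 1\<close> and 312 demands \<open>e\<^sub>j\<^sub>+\<^sub>1 = j\<close> at every ascent.  These sequences are counted
  one letter at a time; for 213 and 231 the counts are Raney numbers.  For 123 and 321, avoidance
  compares a permutation only at pairs of positions fixed in advance, so that the avoiding
  permutations are the linear extensions.
\<close>

section \<open>Lehmer codes\<close>

definition lehmer :: "(nat \<Rightarrow> nat) \<Rightarrow> nat \<Rightarrow> nat" where
  "lehmer \<pi> j = card {i \<in> {1..j}. \<pi> i < \<pi> j}"

lemma lehmer_less: "1 \<le> j \<Longrightarrow> lehmer \<pi> j < j"
proof -
  assume "1 \<le> j"
  have "{i \<in> {1..j}. \<pi> i < \<pi> j} \<subseteq> {1..<j}"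
    using nat_less_le by fastforce
  then have "lehmer \<pi> j \<le> card {1..<j}"
    unfolding lehmer_def by (intro card_mono) auto
  then show ?thesis using \<open>1 \<le> j\<close> by simp
qed

lemma lehmer_Suc: "lehmer \<pi> (Suc j) = card {i \<in> {1..j}. \<pi> i < \<pi> (Suc j)}"
  unfolding lehmer_def by (rule arg_cong[where f = card]) (auto simp: le_Suc_eq)

text \<open>The sets of positions in \<open>{1..j}\<close> whose values lie below a threshold form a
  chain under inclusion, and \<open>i\<close> itself makes the inclusion strict. So the entry at
  \<open>Suc j\<close> and the order of the first \<open>j\<close> values decide every comparison
  with the new value.\<close>

lemma less_last_iff_lehmer:
  assumes "i \<in> {1..j}"
  shows "\<pi> i < \<pi> (Suc j) \<longleftrightarrow> card {l \<in> {1..j}. \<pi> l < \<pi> i} < lehmer \<pi> (Suc j)"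
proof
  assume "\<pi> i < \<pi> (Suc j)"
  then have "{l \<in> {1..j}. \<pi> l < \<pi> i} \<subset> {l \<in> {1..j}. \<pi> l < \<pi> (Suc j)}"
    using assms by auto
  then show "card {l \<in> {1..j}. \<pi> l < \<pi> i} < lehmer \<pi> (Suc j)"
    unfolding lehmer_Suc by (intro psubset_card_mono) auto
next
  assume *: "card {l \<in> {1..j}. \<pi> l < \<pi> i} < lehmer \<pi> (Suc j)"
  show "\<pi> i < \<pi> (Suc j)"
  proof (rule ccontr)
    assume "\<not> ?thesis"
    then have "lehmer \<pi> (Suc j) \<le> card {l \<in> {1..j}. \<pi> l < \<pi> i}"
      unfolding lehmer_Suc by (intro card_mono) auto
    with * show False by simp
  qed
qed

text \<open>Induction on the prefix length: the next entry says where the new value is inserted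
  among the earlier ones, and injectivity then yields the reverse comparisons too.\<close>

lemma lehmer_determines_order:
  assumes "inj_on \<pi> {1..N}" "inj_on \<sigma> {1..N}"
    and "\<And>j. j \<in> {1..N} \<Longrightarrow> lehmer \<pi> j = lehmer \<sigma> j" and "j \<le> N"
  shows "\<forall>i \<in> {1..j}. \<forall>l \<in> {1..j}. \<pi> i < \<pi> l \<longleftrightarrow> \<sigma> i < \<sigma> l"
  using assms(4)
proof (induction j)
  case (Suc j)
  then have IH: "\<forall>i \<in> {1..j}. \<forall>l \<in> {1..j}. \<pi> i < \<pi> l \<longleftrightarrow> \<sigma> i < \<sigma> l" by simp
  have last: "\<pi> i < \<pi> (Suc j) \<longleftrightarrow> \<sigma> i < \<sigma> (Suc j)" if "i \<in> {1..j}" for i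
  proof -
    have "{l \<in> {1..j}. \<pi> l < \<pi> i} = {l \<in> {1..j}. \<sigma> l < \<sigma> i}"
      using IH that by auto
    then show ?thesis
      using assms(3)[of "Suc j"] Suc.prems that by (simp add: less_last_iff_lehmer)
  qed
  have "\<pi> i \<noteq> \<pi> (Suc j)" "\<sigma> i \<noteq> \<sigma> (Suc j)" if "i \<in> {1..j}" for i
    using that Suc.prems inj_onD[OF assms(1), of i "Suc j"] inj_onD[OF assms(2), of i "Suc j"]
    by auto
  then have "\<pi> (Suc j) < \<pi> i \<longleftrightarrow> \<sigma> (Suc j) < \<sigma> i" if "i \<in> {1..j}" for i
    using last[OF that] that by (metis linorder_neqE_nat not_less_iff_gr_or_eq)
  with IH last show ?case
    by (auto simp: le_Suc_eq)
qed simp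

text \<open>The values at most \<open>\<pi> x\<close> fill the interval \<open>{1..\<pi> x}\<close>.
  Hence a permutation can be recovered from its relative order alone.\<close>

lemma permutes_eq_card_le:
  assumes "\<pi> permutes {1..N}" "x \<in> {1..N}"
  shows "\<pi> x = card {y \<in> {1..N}. \<pi> y \<le> \<pi> x}"
proof -
  have "\<pi> x \<le> N" using permutes_in_image[OF assms(1), of x] assms(2) by simp
  have "\<pi> ` {y \<in> {1..N}. \<pi> y \<le> \<pi> x} = {1..\<pi> x}"
  proof
    show "{1..\<pi> x} \<subseteq> \<pi> ` {y \<in> {1..N}. \<pi> y \<le> \<pi> x}"
    proof
      fix v assume v: "v \<in> {1..\<pi> x}"
      with \<open>\<pi> x \<le> N\<close> have "v \<in> \<pi> ` {1..N}" using permutes_image[OF assms(1)] by simp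
      with v show "v \<in> \<pi> ` {y \<in> {1..N}. \<pi> y \<le> \<pi> x}" by auto
    qed
  qed (use permutes_in_image[OF assms(1)] in fastforce)
  moreover have "inj_on \<pi> {y \<in> {1..N}. \<pi> y \<le> \<pi> x}"
    using permutes_inj_on[OF assms(1)] .
  ultimately show ?thesis
    by (metis card_image card_atLeastAtMost diff_Suc_1)
qed

lemma permutes_eqI_order:
  fixes N :: nat
  assumes "\<pi> permutes {1..N}" "\<sigma> permutes {1..N}"
    and "\<And>x y. x \<in> {1..N} \<Longrightarrow> y \<in> {1..N} \<Longrightarrow> \<pi> x \<le> \<pi> y \<longleftrightarrow> \<sigma> x \<le> \<sigma> y"
  shows "\<pi> = \<sigma>"
proof
  fix x show "\<pi> x = \<sigma> x"
  proof (cases "x \<in> {1..N}")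
    case True
    then have "{y \<in> {1..N}. \<pi> y \<le> \<pi> x} = {y \<in> {1..N}. \<sigma> y \<le> \<sigma> x}"
      using assms(3) by auto
    then show ?thesis
      using permutes_eq_card_le[OF assms(1) True] permutes_eq_card_le[OF assms(2) True] by simp
  next
    case False
    then show ?thesis using permutes_not_in assms by metis
  qed
qed

text \<open>Only injectivity is shown directly: both sides have \<open>fact N\<close> elements, so
  surjectivity follows without an explicit inverse.\<close>

lemma bij_betw_lehmer:
  "bij_betw (\<lambda>\<pi>. restrict (lehmer \<pi>) {1..N}) {\<pi>. \<pi> permutes {1..N}} (\<Pi>\<^sub>E j\<in>{1..N}. {..<j})"
proof -
  let ?f = "\<lambda>\<pi>. restrict (lehmer \<pi>) {1..N}"
  have inj: "inj_on ?f {\<pi>. \<pi> permutes {1..N}}"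
  proof (rule inj_onI, unfold mem_Collect_eq)
    fix \<pi> \<sigma> assume p: "\<pi> permutes {1..N}" "\<sigma> permutes {1..N}" and eq: "?f \<pi> = ?f \<sigma>"
    have "lehmer \<pi> j = lehmer \<sigma> j" if "j \<in> {1..N}" for j
      using fun_cong[OF eq, of j] that by simp
    then have "\<forall>i \<in> {1..N}. \<forall>l \<in> {1..N}. \<pi> i < \<pi> l \<longleftrightarrow> \<sigma> i < \<sigma> l"
      using permutes_inj_on[OF p(1)] permutes_inj_on[OF p(2)]
      by (intro lehmer_determines_order[where N = N]) auto
    then show "\<pi> = \<sigma>"
      using p by (intro permutes_eqI_order) (auto simp flip: not_less)
  qed
  have sub: "?f ` {\<pi>. \<pi> permutes {1..N}} \<subseteq> (\<Pi>\<^sub>E j\<in>{1..N}. {..<j})"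
    by (auto simp: lehmer_less)
  have "card (?f ` {\<pi>. \<pi> permutes {1..N}}) = card (\<Pi>\<^sub>E j\<in>{1..N}. {..<j})"
    using inj by (simp add: card_image card_permutations card_PiE fact_prod)
  then have "?f ` {\<pi>. \<pi> permutes {1..N}} = (\<Pi>\<^sub>E j\<in>{1..N}. {..<j})"
    using sub by (intro card_subset_eq finite_PiE) auto
  with inj show ?thesis by (simp add: bij_betw_def)
qed

section \<open>Sequences obeying a local transition rule, and their enumeration\<close>

definition codes :: "(nat \<Rightarrow> nat \<Rightarrow> nat \<Rightarrow> bool) \<Rightarrow> nat \<Rightarrow> (nat \<Rightarrow> nat) set" where
  "codes R N = {e \<in> \<Pi>\<^sub>E j\<in>{1..N}. {..<j}. \<forall>j \<in> {1..<N}. R j (e j) (e (Suc j))}"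

lemma card_eq_card_codes:
  assumes "X \<subseteq> {\<pi>. \<pi> permutes {1..N}}"
    and "\<And>\<pi>. \<pi> permutes {1..N} \<Longrightarrow>
      \<pi> \<in> X \<longleftrightarrow> (\<forall>j \<in> {1..<N}. R j (lehmer \<pi> j) (lehmer \<pi> (Suc j)))"
  shows "card X = card (codes R N)"
proof -
  let ?f = "\<lambda>\<pi>. restrict (lehmer \<pi>) {1..N}"
  have "\<pi> \<in> X \<longleftrightarrow> ?f \<pi> \<in> codes R N" if "\<pi> permutes {1..N}" for \<pi>
    using assms(2)[OF that] by (auto simp: codes_def lehmer_less)
  moreover have "codes R N \<subseteq> ?f ` {\<pi>. \<pi> permutes {1..N}}"
    using bij_betw_imp_surj_on[OF bij_betw_lehmer[of N]] by (auto simp: codes_def)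
  ultimately have "?f ` X = codes R N"
    using assms(1) by blast
  moreover have "inj_on ?f X"
    using bij_betw_imp_inj_on[OF bij_betw_lehmer] assms(1) by (rule inj_on_subset)
  ultimately show ?thesis by (metis card_image)
qed

definition codes_ending :: "(nat \<Rightarrow> nat \<Rightarrow> nat \<Rightarrow> bool) \<Rightarrow> nat \<Rightarrow> nat \<Rightarrow> nat" where
  "codes_ending R N y = card {e \<in> codes R N. e N = y}"

lemma finite_codes: "finite (codes R N)"
proof (rule finite_subset)
  show "codes R N \<subseteq> (\<Pi>\<^sub>E j\<in>{1..N}. {..<j})" by (auto simp: codes_def)
  show "finite (\<Pi>\<^sub>E j\<in>{1..N}. {..<j})" by (intro finite_PiE) auto
qed

lemma card_codes:
  assumes "1 \<le> N"
  shows "card (codes R N) = (\<Sum>y<N. codes_ending R N y)"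
proof -
  have "codes R N = (\<Union>y<N. {e \<in> codes R N. e N = y})"
    using assms by (auto simp: codes_def PiE_iff)
  then have "card (codes R N) = card (\<Union>y<N. {e \<in> codes R N. e N = y})" by simp
  also have "\<dots> = (\<Sum>y<N. card {e \<in> codes R N. e N = y})"
    by (intro card_UN_disjoint) (auto simp: finite_codes)
  finally show ?thesis by (simp add: codes_ending_def)
qed

lemma codes_ending_1: "codes_ending R 1 0 = 1"
proof -
  have "{e \<in> codes R 1. e 1 = 0} = {\<lambda>j\<in>{1}. 0}"
    by (auto simp: codes_def PiE_iff extensional_def fun_eq_iff)
  then show ?thesis by (simp add: codes_ending_def)
qed

text \<open>Deleting the last entry leaves exactly the shorter codes whose own last entry may step
  to \<open>y\<close>. This transfer recursion drives all the counts.\<close>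

lemma codes_ending_Suc:
  assumes "1 \<le> N" "y \<le> N"
  shows "codes_ending R (Suc N) y = (\<Sum>x | x < N \<and> R N x y. codes_ending R N x)"
proof -
  let ?S = "{e \<in> codes R N. R N (e N) y}"
  have "bij_betw (\<lambda>e. e(Suc N := y)) ?S {e \<in> codes R (Suc N). e (Suc N) = y}"
  proof (rule bij_betw_byWitness[where f' = "\<lambda>e. restrict e {1..N}"])
    show "\<forall>e \<in> ?S. restrict (e(Suc N := y)) {1..N} = e"
      by (auto simp: codes_def PiE_iff extensional_def fun_eq_iff)
    show "\<forall>e \<in> {e \<in> codes R (Suc N). e (Suc N) = y}. (restrict e {1..N})(Suc N := y) = e"
      by (auto simp: codes_def PiE_iff extensional_def fun_eq_iff le_Suc_eq)
    show "(\<lambda>e. e(Suc N := y)) ` ?S \<subseteq> {e \<in> codes R (Suc N). e (Suc N) = y}"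
      using assms by (auto simp: codes_def PiE_iff extensional_def less_Suc_eq)
    show "(\<lambda>e. restrict e {1..N}) ` {e \<in> codes R (Suc N). e (Suc N) = y} \<subseteq> ?S"
      using assms by (auto simp: codes_def PiE_iff)
  qed
  then have "codes_ending R (Suc N) y = card ?S"
    by (simp add: codes_ending_def bij_betw_same_card)
  also have "?S = (\<Union>x \<in> {x. x < N \<and> R N x y}. {e \<in> codes R N. e N = x})"
    using assms by (auto simp: codes_def PiE_iff)
  also have "card \<dots> = (\<Sum>x | x < N \<and> R N x y. card {e \<in> codes R N. e N = x})"
    by (intro card_UN_disjoint) (auto simp: finite_codes)
  finally show ?thesis by (simp add: codes_ending_def)
qed

text \<open>\<open>W j x\<close> stands for the number of ways to complete a code with entry
  \<open>x\<close> at position \<open>j\<close> to length \<open>N\<close>.\<close>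

lemma card_codes_backward:
  fixes W :: "nat \<Rightarrow> nat \<Rightarrow> nat"
  assumes "1 \<le> N" and "\<And>x. x < N \<Longrightarrow> W N x = 1"
    and step: "\<And>j x. 1 \<le> j \<Longrightarrow> j < N \<Longrightarrow> x < j \<Longrightarrow> W j x = (\<Sum>y | y \<le> j \<and> R j x y. W (Suc j) y)"
  shows "card (codes R N) = W 1 0"
proof -
  \<comment> \<open>Cutting every code at position \<open>j\<close> gives a total that does not
    depend on \<open>j\<close>. For \<open>j = 1\<close> the only entry is 0; for
    \<open>j = N\<close> all weights are 1 and the total is the number of codes.\<close>
  have "(\<Sum>x<j. codes_ending R j x * W j x) = W 1 0" if "1 \<le> j" "j \<le> N" for j
    using that
  proof (induction j rule: dec_induct)
    case base
    then show ?case using codes_ending_1[of R] by simp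
  next
    case (step j)
    have "(\<Sum>y<Suc j. codes_ending R (Suc j) y * W (Suc j) y) =
        (\<Sum>y<Suc j. \<Sum>x | x < j \<and> R j x y. codes_ending R j x * W (Suc j) y)"
      using step by (intro sum.cong) (auto simp: codes_ending_Suc sum_distrib_right)
    also have "\<dots> = (\<Sum>x<j. \<Sum>y | y < Suc j \<and> R j x y. codes_ending R j x * W (Suc j) y)"
      using sum.swap_restrict[of "{..<Suc j}" "{..<j}"
          "\<lambda>y x. codes_ending R j x * W (Suc j) y" "\<lambda>y x. R j x y"] by simp
    also have "\<dots> = (\<Sum>x<j. codes_ending R j x * W j x)"
      using step assms(3)[of j] by (intro sum.cong) (auto simp: sum_distrib_left less_Suc_eq_le)
    finally show ?case using step by simp
  qed
  from this[of N] show ?thesis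
    using assms(1,2) by (simp add: card_codes)
qed

section \<open>Avoidance in terms of the code\<close>

text \<open>This is the case \<open>i = j\<close> of \<open>less_last_iff_lehmer\<close>, where the
  rank of \<open>\<pi> j\<close> among the first \<open>j\<close> values is its own code
  entry.\<close>

lemma lehmer_descent_iff:
  assumes "\<pi> permutes {1..N}" "j \<in> {1..<N}"
  shows "\<pi> (Suc j) < \<pi> j \<longleftrightarrow> lehmer \<pi> (Suc j) \<le> lehmer \<pi> j"
proof -
  have "\<pi> j \<noteq> \<pi> (Suc j)"
    using permutes_inj[OF assms(1)] by (simp add: inj_eq)
  then show ?thesis
    using less_last_iff_lehmer[of j j \<pi>] assms(2) by (auto simp: lehmer_def)
qed

lemma descent_class_iff:
  assumes "\<pi> permutes {1..N}" "0 < k"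
  shows "\<pi> \<in> descent_class N k \<longleftrightarrow> (\<forall>j \<in> {1..<N}. \<pi> (Suc j) < \<pi> j \<longleftrightarrow> k dvd j)"
proof -
  have "{k * j | j. j \<in> {1..(N - 1) div k}} = {i \<in> {1..N - 1}. k dvd i}"
    using assms(2) by (fastforce simp: less_eq_div_iff_mult_less_eq ac_simps)
  moreover have "{1..N - 1} = {1..<N}" by auto
  ultimately have "\<pi> \<in> descent_class N k \<longleftrightarrow>
      {i \<in> {1..<N}. \<pi> (Suc i) < \<pi> i} = {i \<in> {1..<N}. k dvd i}"
    using assms(1) by (simp only: descent_class_def Des_def mem_Collect_eq Suc_eq_plus1 simp_thms)
  then show ?thesis by blast
qed

lemma avoiders_iff:
  assumes "\<pi> permutes {1..N}" "0 < k"
  shows "\<pi> \<in> avoiders N k p \<longleftrightarrow> (\<forall>j \<in> {1..<N}. (\<pi> (Suc j) < \<pi> j \<longleftrightarrow> k dvd j) \<and>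
    (\<forall>i \<in> {1..<j}. \<not> same_relative_order [\<pi> i, \<pi> j, \<pi> (Suc j)] p))"
  unfolding avoiders_def mem_Collect_eq descent_class_iff[OF assms] contains_vincular_def
  by fastforce

lemma avoiders_subset: "avoiders N k p \<subseteq> {\<pi>. \<pi> permutes {1..N}}"
  by (auto simp: avoiders_def descent_class_def)

lemma same_relative_order_3:
  "same_relative_order [a, b, c] [x, y, z] \<longleftrightarrow>
    (a < b \<longleftrightarrow> x < y) \<and> (b < a \<longleftrightarrow> y < x) \<and> (a < c \<longleftrightarrow> x < z) \<and> (c < a \<longleftrightarrow> z < x) \<and>
    (b < c \<longleftrightarrow> y < z) \<and> (c < b \<longleftrightarrow> z < y)"
  by (simp add: same_relative_order_def All_less_Suc2) argo

lemma permutes_Suc_neq: "\<pi> permutes A \<Longrightarrow> \<pi> j \<noteq> \<pi> (Suc j)"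
  by (simp add: permutes_inj inj_eq)

text \<open>Membership is a conjunction over \<open>j\<close> of conditions on
  \<open>\<pi> j\<close>, \<open>\<pi> (Suc j)\<close> and the earlier values, so each pattern needs
  only a check at a single position.\<close>

lemma card_avoiders_eq_card_codes:
  assumes "0 < k"
    and "\<And>\<pi> j. \<pi> permutes {1..N} \<Longrightarrow> j \<in> {1..<N} \<Longrightarrow>
      (\<pi> (Suc j) < \<pi> j \<longleftrightarrow> k dvd j) \<and> (\<forall>i \<in> {1..<j}. \<not> same_relative_order [\<pi> i, \<pi> j, \<pi> (Suc j)] p) \<longleftrightarrow>
      R j (lehmer \<pi> j) (lehmer \<pi> (Suc j))"
  shows "card (avoiders N k p) = card (codes R N)"
proof (rule card_eq_card_codes[OF avoiders_subset])
  fix \<pi> :: "nat \<Rightarrow> nat" assume p: "\<pi> permutes {1..N}"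
  show "\<pi> \<in> avoiders N k p \<longleftrightarrow> (\<forall>j \<in> {1..<N}. R j (lehmer \<pi> j) (lehmer \<pi> (Suc j)))"
    unfolding avoiders_iff[OF p assms(1)] by (rule ball_cong[OF refl]) (rule assms(2)[OF p])
qed

text \<open>At an ascent the entry grows by one for position \<open>j\<close> itself and by one for
  each earlier value strictly between \<open>\<pi> j\<close> and \<open>\<pi> (Suc j)\<close>. Such
  a value is the letter 2 of an occurrence of 213.\<close>

lemma lehmer_Suc_iff_between:
  assumes "\<pi> permutes {1..N}" "1 \<le> j" "\<pi> j < \<pi> (Suc j)"
  shows "lehmer \<pi> (Suc j) = Suc (lehmer \<pi> j) \<longleftrightarrow> (\<forall>i \<in> {1..<j}. \<not> (\<pi> j < \<pi> i \<and> \<pi> i < \<pi> (Suc j)))"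
proof -
  let ?B = "{i \<in> {1..<j}. \<pi> j < \<pi> i \<and> \<pi> i < \<pi> (Suc j)}"
  have "\<pi> i \<noteq> \<pi> j" if "i < j" for i
    using permutes_inj[OF assms(1)] that by (auto simp: inj_eq)
  then have "{i \<in> {1..j}. \<pi> i < \<pi> (Suc j)} = insert j ({i \<in> {1..j}. \<pi> i < \<pi> j} \<union> ?B)"
    using assms(2,3) by (auto simp: order_le_less) (metis linorder_neqE_nat)+
  moreover have "card (insert j ({i \<in> {1..j}. \<pi> i < \<pi> j} \<union> ?B)) = Suc (lehmer \<pi> j + card ?B)"
    unfolding lehmer_def by (subst card_insert_disjoint, simp, simp) (subst card_Un_disjoint, auto)
  ultimately have "lehmer \<pi> (Suc j) = Suc (lehmer \<pi> j + card ?B)"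
    by (simp only: lehmer_Suc)
  then show ?thesis by auto
qed

text \<open>At a descent neither entry counts position \<open>j\<close>, so the entry drops by the
  number of earlier values strictly in between. Such a value is the letter 2 of an occurrence of
  231.\<close>

lemma lehmer_eq_iff_between:
  assumes "\<pi> permutes {1..N}" "1 \<le> j" "\<pi> (Suc j) < \<pi> j"
  shows "lehmer \<pi> (Suc j) = lehmer \<pi> j \<longleftrightarrow> (\<forall>i \<in> {1..<j}. \<not> (\<pi> (Suc j) < \<pi> i \<and> \<pi> i < \<pi> j))"
proof -
  let ?B = "{i \<in> {1..<j}. \<pi> (Suc j) < \<pi> i \<and> \<pi> i < \<pi> j}"
  have "\<pi> i \<noteq> \<pi> (Suc j)" if "i < j" for i
    using permutes_inj[OF assms(1)] that by (auto simp: inj_eq)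
  then have "{i \<in> {1..j}. \<pi> i < \<pi> j} = {i \<in> {1..j}. \<pi> i < \<pi> (Suc j)} \<union> ?B"
    using assms(2,3) by (auto simp: order_le_less) (metis linorder_neqE_nat)+
  moreover have "card ({i \<in> {1..j}. \<pi> i < \<pi> (Suc j)} \<union> ?B) = lehmer \<pi> (Suc j) + card ?B"
    unfolding lehmer_Suc by (subst card_Un_disjoint) auto
  ultimately have "lehmer \<pi> j = lehmer \<pi> (Suc j) + card ?B"
    by (simp only: lehmer_def)
  then show ?thesis by auto
qed

lemma lehmer_Suc_eq_0_iff: "lehmer \<pi> (Suc j) = 0 \<longleftrightarrow> (\<forall>i \<in> {1..j}. \<not> \<pi> i < \<pi> (Suc j))"
  unfolding lehmer_Suc by auto

lemma lehmer_Suc_eq_iff_max: "lehmer \<pi> (Suc j) = j \<longleftrightarrow> (\<forall>i \<in> {1..j}. \<pi> i < \<pi> (Suc j))"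
proof
  assume "lehmer \<pi> (Suc j) = j"
  then have "{i \<in> {1..j}. \<pi> i < \<pi> (Suc j)} = {1..j}"
    unfolding lehmer_Suc by (intro card_subset_eq) auto
  then show "\<forall>i \<in> {1..j}. \<pi> i < \<pi> (Suc j)" by blast
next
  assume "\<forall>i \<in> {1..j}. \<pi> i < \<pi> (Suc j)"
  then have "{i \<in> {1..j}. \<pi> i < \<pi> (Suc j)} = {1..j}" by blast
  then show "lehmer \<pi> (Suc j) = j" by (simp add: lehmer_Suc)
qed

lemma atLeastAtMost_eq_insert: "Suc 0 \<le> j \<Longrightarrow> {Suc 0..j} = insert j {Suc 0..<j}"
  by auto

text \<open>An occurrence of 132 needs a descent, and there avoidance makes
  \<open>\<pi> (Suc j)\<close> smaller than all earlier values; \<open>\<pi> j\<close> is larger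
  anyway, so the entry is 0.\<close>

lemma card_avoiders_132:
  assumes "0 < k"
  shows "card (avoiders N k [1, 3, 2]) = card (codes (\<lambda>j x y. if k dvd j then y = 0 else x < y) N)"
proof (rule card_avoiders_eq_card_codes[OF assms])
  fix \<pi> :: "nat \<Rightarrow> nat" and j assume p: "\<pi> permutes {1..N}" "j \<in> {1..<N}"
  have "same_relative_order [a, b, c] [1, 3, 2] \<longleftrightarrow> a < c \<and> c < b" for a b c
    unfolding same_relative_order_3 by auto
  then show "(\<pi> (Suc j) < \<pi> j \<longleftrightarrow> k dvd j) \<and>
      (\<forall>i \<in> {1..<j}. \<not> same_relative_order [\<pi> i, \<pi> j, \<pi> (Suc j)] [1, 3, 2]) \<longleftrightarrow>
      (if k dvd j then lehmer \<pi> (Suc j) = 0 else lehmer \<pi> j < lehmer \<pi> (Suc j))"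
    using p permutes_Suc_neq[OF p(1), of j]
    by (auto simp: lehmer_descent_iff[OF p, symmetric] lehmer_Suc_eq_0_iff atLeastAtMost_eq_insert
        simp flip: not_le[of "lehmer \<pi> (Suc j)"])
qed

text \<open>An occurrence of 213 needs an ascent, so multiples of \<open>k\<close> keep only the
  descent condition. Elsewhere \<open>y = Suc x\<close> encodes the ascent and the avoidance at
  once.\<close>

lemma card_avoiders_213:
  assumes "0 < k"
  shows "card (avoiders N k [2, 1, 3]) = card (codes (\<lambda>j x y. if k dvd j then y \<le> x else y = Suc x) N)"
proof (rule card_avoiders_eq_card_codes[OF assms])
  fix \<pi> :: "nat \<Rightarrow> nat" and j assume p: "\<pi> permutes {1..N}" "j \<in> {1..<N}"
  have "same_relative_order [a, b, c] [2, 1, 3] \<longleftrightarrow> b < a \<and> a < c" for a b c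
    unfolding same_relative_order_3 by auto
  then show "(\<pi> (Suc j) < \<pi> j \<longleftrightarrow> k dvd j) \<and>
      (\<forall>i \<in> {1..<j}. \<not> same_relative_order [\<pi> i, \<pi> j, \<pi> (Suc j)] [2, 1, 3]) \<longleftrightarrow>
      (if k dvd j then lehmer \<pi> (Suc j) \<le> lehmer \<pi> j else lehmer \<pi> (Suc j) = Suc (lehmer \<pi> j))"
    using p permutes_Suc_neq[OF p(1), of j] lehmer_descent_iff[OF p] lehmer_Suc_iff_between[OF p(1), of j]
    by (cases "\<pi> (Suc j) < \<pi> j") auto
qed

text \<open>Here the roles of ascents and descents are exchanged: \<open>y = x\<close> encodes a
  descent together with avoidance, and ascents cannot carry an occurrence.\<close>

lemma card_avoiders_231:
  assumes "0 < k"
  shows "card (avoiders N k [2, 3, 1]) = card (codes (\<lambda>j x y. if k dvd j then y = x else x < y) N)"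
proof (rule card_avoiders_eq_card_codes[OF assms])
  fix \<pi> :: "nat \<Rightarrow> nat" and j assume p: "\<pi> permutes {1..N}" "j \<in> {1..<N}"
  have "same_relative_order [a, b, c] [2, 3, 1] \<longleftrightarrow> c < a \<and> a < b" for a b c
    unfolding same_relative_order_3 by auto
  then show "(\<pi> (Suc j) < \<pi> j \<longleftrightarrow> k dvd j) \<and>
      (\<forall>i \<in> {1..<j}. \<not> same_relative_order [\<pi> i, \<pi> j, \<pi> (Suc j)] [2, 3, 1]) \<longleftrightarrow>
      (if k dvd j then lehmer \<pi> (Suc j) = lehmer \<pi> j else lehmer \<pi> j < lehmer \<pi> (Suc j))"
    using p permutes_Suc_neq[OF p(1), of j] lehmer_descent_iff[OF p] lehmer_eq_iff_between[OF p(1), of j]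
    by (cases "\<pi> (Suc j) < \<pi> j") auto
qed

text \<open>At an ascent, avoidance puts \<open>\<pi> (Suc j)\<close> above all earlier values,
  which means that the entry takes its largest possible value \<open>j\<close>.\<close>

lemma card_avoiders_312:
  assumes "0 < k"
  shows "card (avoiders N k [3, 1, 2]) = card (codes (\<lambda>j x y. if k dvd j then y \<le> x else y = j) N)"
proof (rule card_avoiders_eq_card_codes[OF assms])
  fix \<pi> :: "nat \<Rightarrow> nat" and j assume p: "\<pi> permutes {1..N}" "j \<in> {1..<N}"
  have *: "same_relative_order [a, b, c] [3, 1, 2] \<longleftrightarrow> b < c \<and> c < a" for a b c
    unfolding same_relative_order_3 by auto
  have "\<pi> i \<noteq> \<pi> (Suc j)" if "i < j" for i
    using permutes_inj[OF p(1)] that by (auto simp: inj_eq)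
  then have **: "(\<forall>i \<in> {1..<j}. \<not> \<pi> (Suc j) < \<pi> i) \<longleftrightarrow> (\<forall>i \<in> {1..<j}. \<pi> i < \<pi> (Suc j))"
    by (metis atLeastLessThan_iff linorder_neqE_nat not_less_iff_gr_or_eq)
  show "(\<pi> (Suc j) < \<pi> j \<longleftrightarrow> k dvd j) \<and>
      (\<forall>i \<in> {1..<j}. \<not> same_relative_order [\<pi> i, \<pi> j, \<pi> (Suc j)] [3, 1, 2]) \<longleftrightarrow>
      (if k dvd j then lehmer \<pi> (Suc j) \<le> lehmer \<pi> j else lehmer \<pi> (Suc j) = j)"
  proof (cases "\<pi> (Suc j) < \<pi> j")
    case True
    \<comment> \<open>The rule \<open>y = j\<close> also has to exclude a descent at a position not
      divisible by \<open>k\<close>; the larger value \<open>\<pi> j\<close> does so.\<close>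
    then have "lehmer \<pi> (Suc j) \<noteq> j"
      using p(2) by (auto simp: lehmer_Suc_eq_iff_max intro!: bexI[of _ j])
    with True show ?thesis using lehmer_descent_iff[OF p] unfolding * by simp
  next
    case False
    then have "\<pi> j < \<pi> (Suc j)" using permutes_Suc_neq[OF p(1), of j] by simp
    then show ?thesis
      using False p(2) lehmer_descent_iff[OF p] ** unfolding *
      by (simp add: lehmer_Suc_eq_iff_max atLeastAtMost_eq_insert)
  qed
qed

section \<open>Linear extensions\<close>

text \<open>A linear order on \<open>{1..N}\<close> is the same as the permutation sending each
  element to its rank, and extending \<open>P\<close> means that this permutation is monotone along
  \<open>P\<close>.\<close>

lemma LE_eq_card_permutations:
  assumes "P \<subseteq> {1..N} \<times> {1..N}"
  shows "LE {1..N} P = card {\<pi>. \<pi> permutes {1..N} \<and> (\<forall>(x, y) \<in> P. \<pi> x \<le> \<pi> y)}"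
proof -
  let ?A = "{1..N}"
  define L where "L \<pi> = {(x, y) \<in> ?A \<times> ?A. \<pi> x \<le> \<pi> y}" for \<pi> :: "nat \<Rightarrow> nat"
  have inj: "inj_on L {\<pi>. \<pi> permutes ?A}"
  proof (rule inj_onI, unfold mem_Collect_eq)
    fix \<pi> \<sigma> assume p: "\<pi> permutes ?A" "\<sigma> permutes ?A" and "L \<pi> = L \<sigma>"
    then have "(x, y) \<in> L \<pi> \<longleftrightarrow> (x, y) \<in> L \<sigma>" for x y by simp
    then show "\<pi> = \<sigma>" using p by (intro permutes_eqI_order) (auto simp: L_def)
  qed
  have linear: "linear_order_on ?A (L \<pi>)" if "\<pi> permutes ?A" for \<pi>
    using permutes_inj[OF that]
    by (auto simp: L_def linear_order_on_def partial_order_on_def preorder_on_def refl_on_def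
        trans_def antisym_def total_on_def inj_eq)
  have surj: "\<exists>\<pi>. \<pi> permutes ?A \<and> L \<pi> = M" if "linear_order_on ?A M" for M
  proof -
    have M: "M \<subseteq> ?A \<times> ?A" "\<And>x. x \<in> ?A \<Longrightarrow> (x, x) \<in> M" "trans M" "antisym M" "total_on ?A M"
      using that by (auto simp: linear_order_on_def partial_order_on_def preorder_on_def refl_on_def)
    \<comment> \<open>The rank in \<open>M\<close>, extended by the identity so that it permutes
      \<open>{1..N}\<close>.\<close>
    define \<rho> where "\<rho> x = (if x \<in> ?A then card {y \<in> ?A. (y, x) \<in> M} else x)" for x
    have mono: "\<rho> x \<le> \<rho> y \<longleftrightarrow> (x, y) \<in> M" if xy: "x \<in> ?A" "y \<in> ?A" for x y
    proof
      assume "(x, y) \<in> M"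
      then have "{z \<in> ?A. (z, x) \<in> M} \<subseteq> {z \<in> ?A. (z, y) \<in> M}"
        using M(3) by (auto dest: transD)
      then show "\<rho> x \<le> \<rho> y" using xy by (simp add: \<rho>_def card_mono)
    next
      assume le: "\<rho> x \<le> \<rho> y"
      show "(x, y) \<in> M"
      proof (rule ccontr)
        assume nxy: "(x, y) \<notin> M"
        then have "(y, x) \<in> M" using M(2,5) xy unfolding total_on_def by metis
        then have "{z \<in> ?A. (z, y) \<in> M} \<subset> {z \<in> ?A. (z, x) \<in> M}"
          using nxy M(2)[OF xy(1)] M(3) xy(1) by (auto dest: transD)
        then have "\<rho> y < \<rho> x" using xy by (simp add: \<rho>_def psubset_card_mono)
        with le show False by simp
      qed
    qed
    have "\<rho> x \<in> ?A" if "x \<in> ?A" for x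
    proof -
      have "card {y \<in> ?A. (y, x) \<in> M} \<le> card ?A" by (intro card_mono) auto
      moreover have "{y \<in> ?A. (y, x) \<in> M} \<noteq> {}" using that M(2) by blast
      then have "0 < card {y \<in> ?A. (y, x) \<in> M}" by (simp add: card_gt_0_iff)
      ultimately show ?thesis using that by (simp add: \<rho>_def)
    qed
    moreover have "inj_on \<rho> ?A"
      using mono M(4) by (intro inj_onI) (metis antisymD order_refl)
    ultimately have "bij_betw \<rho> ?A ?A"
      by (simp add: bij_betw_def endo_inj_surj image_subset_iff)
    then have "\<rho> permutes ?A" by (rule bij_imp_permutes) (auto simp: \<rho>_def)
    moreover have "L \<rho> = M" using mono M(1) by (auto simp: L_def)
    ultimately show ?thesis by blast
  qed
  have P: "P \<subseteq> L \<pi> \<longleftrightarrow> (\<forall>(x, y) \<in> P. \<pi> x \<le> \<pi> y)" for \<pi>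
    using assms by (auto simp: L_def)
  let ?S = "{\<pi>. \<pi> permutes ?A \<and> (\<forall>(x, y) \<in> P. \<pi> x \<le> \<pi> y)}"
  have "L ` ?S = {M. linear_order_on ?A M \<and> P \<subseteq> M}"
    unfolding P[symmetric] using linear surj by blast
  moreover have "card (L ` ?S) = card ?S"
    using inj by (intro card_image) (rule inj_on_subset, auto)
  ultimately show ?thesis by (simp only: LE_def)
qed

text \<open>Weak monotonicity is transitive, so only generating relations need testing; being weak,
  it also holds on the reflexive pairs.\<close>

lemma monotone_trancl_iff:
  fixes f :: "'a \<Rightarrow> nat"
  shows "(\<forall>(x, y) \<in> G\<^sup>+. f x \<le> f y) \<longleftrightarrow> (\<forall>(x, y) \<in> G. f x \<le> f y)"
proof
  assume G: "\<forall>(x, y) \<in> G. f x \<le> f y"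
  have "f x \<le> f y" if "(x, y) \<in> G\<^sup>+" for x y
    using that by induction (use G in fastforce)+
  then show "\<forall>(x, y) \<in> G\<^sup>+. f x \<le> f y" by blast
qed auto

section \<open>Block positions as residues modulo \<open>k\<close>\<close>

lemma block_pos_add_1: "block_pos k i (a + 1) = Suc (block_pos k i a)"
  by (simp add: block_pos_def)

lemma block_pos_last: "1 \<le> i \<Longrightarrow> block_pos k i k = i * k"
  by (cases i) (simp_all add: block_pos_def)

lemma block_pos_first: "1 \<le> i \<Longrightarrow> block_pos k (i + 1) 1 = Suc (block_pos k i k)"
  unfolding block_pos_last by (simp add: block_pos_def)

lemma ascent_positions:
  assumes "1 \<le> s" "s \<le> k"
  shows "(\<lambda>(i, a). block_pos k i a) ` ascent_indices m s k = {j \<in> {1..<m * k + s}. \<not> k dvd j}"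
proof (intro set_eqI iffI)
  fix x assume "x \<in> (\<lambda>(i, a). block_pos k i a) ` ascent_indices m s k"
  then obtain i a where ia: "(i, a) \<in> ascent_indices m s k" and x: "x = block_pos k i a" by auto
  note D = ascent_indicesD[OF ia assms(2)]
  have "x mod k = a" using D(4) by (simp add: x block_pos_def)
  then show "x \<in> {j \<in> {1..<m * k + s}. \<not> k dvd j}"
    using D(3,5,6) unfolding block_pos_add_1 by (auto simp: x dvd_eq_mod_eq_0)
next
  fix x assume "x \<in> {j \<in> {1..<m * k + s}. \<not> k dvd j}"
  then have x: "x < m * k + s" "\<not> k dvd x" by auto
  have k: "0 < k" using assms by simp
  have eq: "x div k * k + x mod k = x" by simp
  have "x < Suc m * k" using x assms by simp
  then have "x div k < Suc m" by (rule less_mult_imp_div_less)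
  then have "x div k \<le> m" by simp
  moreover have "Suc (x mod k) \<le> s" if "x div k = m"
    using x(1) eq unfolding that by linarith
  ultimately have "(x div k + 1, x mod k) \<in> ascent_indices m s k"
    using x(2) k by (auto simp: ascent_indices_def block_length_def dvd_eq_mod_eq_0 Suc_le_eq)
  moreover have "x = block_pos k (x div k + 1) (x mod k)" by (simp add: block_pos_def)
  ultimately show "x \<in> (\<lambda>(i, a). block_pos k i a) ` ascent_indices m s k" by force
qed

text \<open>The ends of the first \<open>m\<close> blocks are the multiples \<open>i * k\<close>.
  The bound \<open>j < m * k + s\<close> excludes the end of the last block, which is a multiple of
  \<open>k\<close> when \<open>s = k\<close>.\<close>

lemma descent_positions:
  assumes "1 \<le> s" "s \<le> k"
  shows "(\<lambda>i. block_pos k i k) ` {1..m} = {j \<in> {1..<m * k + s}. k dvd j}"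
proof (intro set_eqI iffI)
  fix x assume "x \<in> (\<lambda>i. block_pos k i k) ` {1..m}"
  then obtain i where i: "1 \<le> i" "i \<le> m" "x = i * k" by (auto simp: block_pos_last)
  then have "i * k \<le> m * k" "1 * k \<le> i * k" by (simp_all only: mult_le_mono1)
  then have "1 \<le> i * k" "i * k < m * k + s" using assms by linarith+
  then show "x \<in> {j \<in> {1..<m * k + s}. k dvd j}" using i(3) by simp
next
  fix x assume "x \<in> {j \<in> {1..<m * k + s}. k dvd j}"
  then obtain i where i: "x = k * i" "1 \<le> x" "x < m * k + s" by (auto elim: dvdE)
  then have "k * i < k * Suc m" using assms(2) by (simp add: algebra_simps)
  then have "i \<in> {1..m}" using i by (cases i) auto
  then show "x \<in> (\<lambda>i. block_pos k i k) ` {1..m}" using i(1) by (auto simp: block_pos_last)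
qed

lemma monotone_block_poset_iff:
  fixes f :: "nat \<Rightarrow> nat"
  assumes "1 \<le> s" "s \<le> k"
  shows "(\<forall>(x, y) \<in> block_poset m s k. f x \<le> f y) \<longleftrightarrow>
    (\<forall>j \<in> {1..<m * k + s}. if k dvd j then f (Suc j) \<le> f j else f j \<le> f (Suc j))"
proof -
  have asc: "{(block_pos k i a, block_pos k i (a + 1)) | i a. (i, a) \<in> ascent_indices m s k} =
      (\<lambda>j. (j, Suc j)) ` {j \<in> {1..<m * k + s}. \<not> k dvd j}"
    unfolding ascent_positions[OF assms, symmetric] block_pos_add_1 by force
  have desc: "{(block_pos k (i + 1) 1, block_pos k i k) | i. i \<in> {1..m}} =
      (\<lambda>j. (Suc j, j)) ` {j \<in> {1..<m * k + s}. k dvd j}"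
    unfolding descent_positions[OF assms, symmetric] Setcompr_eq_image image_image
    by (intro image_cong refl) (simp only: block_pos_first atLeastAtMost_iff)
  let ?N = "m * k + s"
  have "(\<forall>(x, y) \<in> Id_on {1..?N}. f x \<le> f y) \<longleftrightarrow> True"
    "(\<forall>(x, y) \<in> (\<lambda>j. (j, Suc j)) ` {j \<in> {1..<?N}. \<not> k dvd j}. f x \<le> f y) \<longleftrightarrow>
      (\<forall>j \<in> {1..<?N}. \<not> k dvd j \<longrightarrow> f j \<le> f (Suc j))"
    "(\<forall>(x, y) \<in> (\<lambda>j. (Suc j, j)) ` {j \<in> {1..<?N}. k dvd j}. f x \<le> f y) \<longleftrightarrow>
      (\<forall>j \<in> {1..<?N}. k dvd j \<longrightarrow> f (Suc j) \<le> f j)"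
    by auto
  then show ?thesis
    unfolding block_poset_def add_relations_def monotone_trancl_iff asc desc ball_Un if_bool_eq_conj
      ball_conj_distrib by (simp only:) blast
qed

text \<open>Monotonicity along the block poset already fixes all descents, as neighbouring values
  differ. So \<open>R\<close> has to express avoidance only for permutations with the right
  descents.\<close>

lemma card_avoiders_eq_LE:
  assumes "1 \<le> s" "s \<le> k" and R: "R \<subseteq> {1..m * k + s} \<times> {1..m * k + s}"
    and "\<And>\<pi>. \<pi> permutes {1..m * k + s} \<Longrightarrow>
      (\<forall>j \<in> {1..<m * k + s}. if k dvd j then \<pi> (Suc j) < \<pi> j else \<pi> j < \<pi> (Suc j)) \<Longrightarrow>
      (\<forall>(x, y) \<in> R. \<pi> x \<le> \<pi> y) \<longleftrightarrow>
      (\<forall>j \<in> {1..<m * k + s}. \<forall>i \<in> {1..<j}. \<not> same_relative_order [\<pi> i, \<pi> j, \<pi> (Suc j)] p)"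
  shows "card (avoiders (m * k + s) k p) = LE {1..m * k + s} (add_relations (block_poset m s k) R)"
proof -
  let ?N = "m * k + s"
  have "add_relations (block_poset m s k) R \<subseteq> {1..?N} \<times> {1..?N}"
    unfolding add_relations_def using R block_poset_subset[OF assms(1,2)]
    by (intro trancl_subset_Sigma) blast
  then have "LE {1..?N} (add_relations (block_poset m s k) R) =
      card {\<pi>. \<pi> permutes {1..?N} \<and> (\<forall>(x, y) \<in> add_relations (block_poset m s k) R. \<pi> x \<le> \<pi> y)}"
    by (rule LE_eq_card_permutations)
  also have "{\<pi>. \<pi> permutes {1..?N} \<and> (\<forall>(x, y) \<in> add_relations (block_poset m s k) R. \<pi> x \<le> \<pi> y)} =
      avoiders ?N k p"
  proof (intro set_eqI)
    fix \<pi>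
    show "\<pi> \<in> {\<pi>. \<pi> permutes {1..?N} \<and> (\<forall>(x, y) \<in> add_relations (block_poset m s k) R. \<pi> x \<le> \<pi> y)} \<longleftrightarrow>
      \<pi> \<in> avoiders ?N k p"
    proof (cases "\<pi> permutes {1..?N}")
      case True
      have k: "0 < k" using assms by simp
      have "(if k dvd j then \<pi> (Suc j) \<le> \<pi> j else \<pi> j \<le> \<pi> (Suc j)) \<longleftrightarrow>
          (if k dvd j then \<pi> (Suc j) < \<pi> j else \<pi> j < \<pi> (Suc j))" for j
        using permutes_Suc_neq[OF True, of j] by auto
      moreover have "(\<pi> (Suc j) < \<pi> j \<longleftrightarrow> k dvd j) \<longleftrightarrow>
          (if k dvd j then \<pi> (Suc j) < \<pi> j else \<pi> j < \<pi> (Suc j))" for j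
        using permutes_Suc_neq[OF True, of j] by auto
      ultimately show ?thesis
        using assms(4)[OF True] True
        unfolding mem_Collect_eq avoiders_iff[OF True k] add_relations_def monotone_trancl_iff
          ball_Un monotone_block_poset_iff[OF assms(1,2)]
        by (simp only: ball_conj_distrib) blast
    qed (auto simp: avoiders_def descent_class_def)
  qed
  finally show ?thesis ..
qed

text \<open>An occurrence of 123 ends in an ascent at some \<open>j\<close> not divisible by
  \<open>k\<close>, so avoidance says that \<open>\<pi> j\<close> lies below all earlier
  values.\<close>

lemma card_avoiders_123:
  assumes "1 \<le> s" "s \<le> k"
  shows "card (avoiders (m * k + s) k [1, 2, 3]) = LE {1..m * k + s} (poset_123 m s k)"
proof -
  let ?N = "m * k + s"
  have R: "{(block_pos k i a, y) | i a y. (i, a) \<in> ascent_indices m s k \<and> y \<in> {1..<block_pos k i a}} =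
      (\<Union>j \<in> {j \<in> {1..<?N}. \<not> k dvd j}. {j} \<times> {1..<j})"
    unfolding ascent_positions[OF assms, symmetric] by force
  have pat: "same_relative_order [a, b, c] [1, 2, 3] \<longleftrightarrow> a < b \<and> b < c" for a b c
    unfolding same_relative_order_3 by auto
  show ?thesis
    unfolding poset_123_def R
  proof (rule card_avoiders_eq_LE[OF assms])
    show "(\<Union>j \<in> {j \<in> {1..<?N}. \<not> k dvd j}. {j} \<times> {1..<j}) \<subseteq> {1..?N} \<times> {1..?N}" by auto
  next
    fix \<pi> :: "nat \<Rightarrow> nat"
    assume des: "\<forall>j \<in> {1..<?N}. if k dvd j then \<pi> (Suc j) < \<pi> j else \<pi> j < \<pi> (Suc j)"
    have "(\<forall>(x, y) \<in> (\<Union>j \<in> {j \<in> {1..<?N}. \<not> k dvd j}. {j} \<times> {1..<j}). \<pi> x \<le> \<pi> y) \<longleftrightarrow>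
        (\<forall>j \<in> {1..<?N}. \<not> k dvd j \<longrightarrow> (\<forall>i \<in> {1..<j}. \<pi> j \<le> \<pi> i))" by blast
    also have "\<dots> \<longleftrightarrow> (\<forall>j \<in> {1..<?N}. \<forall>i \<in> {1..<j}.
        \<not> same_relative_order [\<pi> i, \<pi> j, \<pi> (Suc j)] [1, 2, 3])"
    proof (rule ball_cong[OF refl])
      fix j assume "j \<in> {1..<?N}"
      from bspec[OF des this] show "(\<not> k dvd j \<longrightarrow> (\<forall>i \<in> {1..<j}. \<pi> j \<le> \<pi> i)) \<longleftrightarrow>
          (\<forall>i \<in> {1..<j}. \<not> same_relative_order [\<pi> i, \<pi> j, \<pi> (Suc j)] [1, 2, 3])"
        unfolding pat not_less[symmetric] by (cases "k dvd j") simp_all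
    qed
    finally show "(\<forall>(x, y) \<in> (\<Union>j \<in> {j \<in> {1..<?N}. \<not> k dvd j}. {j} \<times> {1..<j}). \<pi> x \<le> \<pi> y) \<longleftrightarrow>
        (\<forall>j \<in> {1..<?N}. \<forall>i \<in> {1..<j}.
          \<not> same_relative_order [\<pi> i, \<pi> j, \<pi> (Suc j)] [1, 2, 3])" .
  qed
qed

text \<open>Dually, an occurrence ends in a descent at a multiple \<open>j\<close> of
  \<open>k\<close>, so avoidance says that \<open>\<pi> j\<close> lies above all earlier
  values.\<close>

lemma card_avoiders_321:
  assumes "1 \<le> s" "s \<le> k"
  shows "card (avoiders (m * k + s) k [3, 2, 1]) = LE {1..m * k + s} (poset_321 m s k)"
proof -
  let ?N = "m * k + s"
  have R: "{(y, block_pos k i k) | i y. i \<in> {1..m} \<and> y \<in> {1..<block_pos k i k}} =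
      (\<Union>j \<in> {j \<in> {1..<?N}. k dvd j}. {1..<j} \<times> {j})"
    unfolding descent_positions[OF assms, symmetric] by force
  have pat: "same_relative_order [a, b, c] [3, 2, 1] \<longleftrightarrow> c < b \<and> b < a" for a b c
    unfolding same_relative_order_3 by auto
  show ?thesis
    unfolding poset_321_def R
  proof (rule card_avoiders_eq_LE[OF assms])
    show "(\<Union>j \<in> {j \<in> {1..<?N}. k dvd j}. {1..<j} \<times> {j}) \<subseteq> {1..?N} \<times> {1..?N}" by auto
  next
    fix \<pi> :: "nat \<Rightarrow> nat"
    assume des: "\<forall>j \<in> {1..<?N}. if k dvd j then \<pi> (Suc j) < \<pi> j else \<pi> j < \<pi> (Suc j)"
    have "(\<forall>(x, y) \<in> (\<Union>j \<in> {j \<in> {1..<?N}. k dvd j}. {1..<j} \<times> {j}). \<pi> x \<le> \<pi> y) \<longleftrightarrow>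
        (\<forall>j \<in> {1..<?N}. k dvd j \<longrightarrow> (\<forall>i \<in> {1..<j}. \<pi> i \<le> \<pi> j))" by blast
    also have "\<dots> \<longleftrightarrow> (\<forall>j \<in> {1..<?N}. \<forall>i \<in> {1..<j}.
        \<not> same_relative_order [\<pi> i, \<pi> j, \<pi> (Suc j)] [3, 2, 1])"
    proof (rule ball_cong[OF refl])
      fix j assume "j \<in> {1..<?N}"
      from bspec[OF des this] show "(k dvd j \<longrightarrow> (\<forall>i \<in> {1..<j}. \<pi> i \<le> \<pi> j)) \<longleftrightarrow>
          (\<forall>i \<in> {1..<j}. \<not> same_relative_order [\<pi> i, \<pi> j, \<pi> (Suc j)] [3, 2, 1])"
        unfolding pat not_less[symmetric] by (cases "k dvd j") simp_all
    qed
    finally show "(\<forall>(x, y) \<in> (\<Union>j \<in> {j \<in> {1..<?N}. k dvd j}. {1..<j} \<times> {j}). \<pi> x \<le> \<pi> y) \<longleftrightarrow>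
        (\<forall>j \<in> {1..<?N}. \<forall>i \<in> {1..<j}.
          \<not> same_relative_order [\<pi> i, \<pi> j, \<pi> (Suc j)] [3, 2, 1])" .
  qed
qed

text \<open>Positions 1 and 2 are both ascents, so the first three letters form an
  occurrence.\<close>

lemma avoiders_123_empty:
  assumes "3 \<le> k" "3 \<le> N"
  shows "avoiders N k [1, 2, 3] = {}"
proof (rule ccontr)
  assume "\<not> ?thesis"
  then obtain \<pi> where "\<pi> \<in> avoiders N k [1, 2, 3]" by blast
  moreover from this have p: "\<pi> permutes {1..N}" using avoiders_subset by blast
  ultimately have *: "\<forall>j \<in> {1..<N}. (\<pi> (Suc j) < \<pi> j \<longleftrightarrow> k dvd j) \<and>
      (\<forall>i \<in> {1..<j}. \<not> same_relative_order [\<pi> i, \<pi> j, \<pi> (Suc j)] [1, 2, 3])"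
    using assms by (subst (asm) avoiders_iff) auto
  have "\<not> k dvd 1" "\<not> k dvd 2" using assms by (auto dest: dvd_imp_le)
  then have "\<pi> 1 < \<pi> 2" "\<pi> 2 < \<pi> 3"
    using bspec[OF *, of 1] bspec[OF *, of 2] assms permutes_Suc_neq[OF p, of 1] permutes_Suc_neq[OF p, of 2]
    by (auto simp: numeral_eq_Suc)
  moreover have "\<not> same_relative_order [\<pi> 1, \<pi> 2, \<pi> 3] [1, 2, 3]"
    using bspec[OF *, of 2] assms by (auto simp: numeral_eq_Suc)
  ultimately show False by (auto simp: same_relative_order_3)
qed

section \<open>Raney numbers\<close>

text \<open>The coefficient of \<open>x^n\<close> in \<open>B^a\<close>, where
  \<open>B = 1 + x * B^k\<close>; the recursion is
  \<open>B^(a+1) = B^a + x * B^(a+k)\<close>.\<close>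

fun raney :: "nat \<Rightarrow> nat \<Rightarrow> nat \<Rightarrow> nat" where
  "raney k 0 a = 1"
| "raney k (Suc n) 0 = 0"
| "raney k (Suc n) (Suc a) = raney k (Suc n) a + raney k n (a + k)"

text \<open>Both terms of the recursion share the same top index \<open>M = a + k * (n + 1)\<close>,
  so absorption identities combine their binomials. The product form avoids dividing by zero at
  \<open>a = n = 0\<close>.\<close>

lemma raney_closed_form:
  assumes "0 < k"
  shows "(a + k * n) * raney k n a = a * ((a + k * n) choose n)"
  using assms
proof (induction k n a rule: raney.induct)
  case (3 k n a)
  define M where "M = a + k * Suc n"
  define q where "q = M - n"
  define C where "C = M choose n"
  have "n \<le> k * n" using \<open>0 < k\<close> by simp
  then have "n \<le> M" unfolding M_def mult_Suc_right by linarith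
  then have M: "M = n + q" "0 < M" using \<open>0 < k\<close> by (simp_all add: M_def q_def)
  have X: "M * raney k (Suc n) a = a * (M choose Suc n)"
    using 3 by (simp add: M_def)
  have Y: "M * raney k n (a + k) = (a + k) * C"
    using 3 by (simp add: M_def C_def algebra_simps)
  have C1: "Suc n * (M choose Suc n) = q * C"
    unfolding q_def C_def by (metis binomial_absorb_comp binomial_absorption)
  have "M * (Suc n * raney k (Suc n) (Suc a)) = Suc n * (M * raney k (Suc n) a) + Suc n * (M * raney k n (a + k))"
    by (simp add: algebra_simps)
  also have "\<dots> = a * (Suc n * (M choose Suc n)) + Suc n * ((a + k) * C)"
    unfolding X Y by (simp add: algebra_simps)
  also have "\<dots> = (a * (n + q) + (a + k * Suc n)) * C"
    unfolding C1 by (simp add: algebra_simps)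
  also have "\<dots> = M * (Suc a * C)"
    by (simp only: M(1)[symmetric] M_def[symmetric]) (simp add: algebra_simps)
  finally have *: "Suc n * raney k (Suc n) (Suc a) = Suc a * C"
    using M(2) by simp
  have "Suc n * (Suc M * raney k (Suc n) (Suc a)) = Suc M * (Suc n * raney k (Suc n) (Suc a))"
    by (simp only: ac_simps)
  also have "\<dots> = Suc a * (Suc M * C)"
    unfolding * by (simp only: ac_simps)
  also have "Suc M * C = Suc n * (Suc M choose Suc n)"
    unfolding C_def by (rule Suc_times_binomial[symmetric])
  finally have "Suc n * (Suc M * raney k (Suc n) (Suc a)) = Suc n * (Suc a * (Suc M choose Suc n))"
    by (simp only: ac_simps)
  then have "Suc M * raney k (Suc n) (Suc a) = Suc a * (Suc M choose Suc n)"
    by (simp only: mult_cancel1) simp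
  then show ?case by (simp only: M_def add_Suc)
qed auto

text \<open>The recursion telescopes, starting from \<open>raney k (Suc n) 0 = 0\<close>.\<close>

lemma sum_raney_shift: "(\<Sum>y\<le>x. raney k n (y + k)) = raney k (Suc n) (Suc x)"
  by (induction x) auto

text \<open>Adding the term \<open>e = d\<close> to the sum from \<open>Suc d\<close> is one
  recursion step, because \<open>r + 1 + (k - 1) * (d + 1) = r + (k - 1) * d + k\<close>.\<close>

lemma sum_raney_diagonal:
  assumes "d \<le> i" "0 < k"
  shows "(\<Sum>e = d..i. raney k (i - e) (r + (k - 1) * e)) = raney k (i - d) (Suc r + (k - 1) * d)"
  using assms(1)
proof (induction d rule: inc_induct)
  case (step d)
  then have *: "i - d = Suc (i - Suc d)" by simp
  have "Suc r + (k - 1) * Suc d = r + (k - 1) * d + k" using assms(2) by (cases k) simp_all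
  then show ?case
    using step by (simp add: sum.atLeast_Suc_atMost[of d i] * ac_simps)
qed simp

section \<open>Counting the codes\<close>

text \<open>Position \<open>Suc j\<close> has \<open>j div k\<close> full blocks before it and
  zero-based place \<open>j mod k\<close> in its own block. Here it closes that block.\<close>

lemma block_index_Suc:
  fixes k :: nat
  assumes "k dvd Suc j" "0 < k"
  shows "Suc (j mod k) = k" "Suc j mod k = 0" "Suc j div k = Suc (j div k)" "Suc j = k * Suc (j div k)"
proof -
  show *: "Suc j mod k = 0" "Suc j div k = Suc (j div k)"
    using assms by (simp_all add: div_Suc)
  show "Suc j = k * Suc (j div k)" using assms(1) *(2) by (metis dvd_mult_div_cancel)
  show "Suc (j mod k) = k" using *(1) assms(2) by (auto simp: mod_Suc split: if_splits)
qed

lemma block_index_Suc':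
  fixes k :: nat
  assumes "\<not> k dvd Suc j"
  shows "Suc j mod k = Suc (j mod k)" "Suc j div k = j div k"
proof -
  show "Suc j div k = j div k" using assms by (simp add: div_Suc dvd_eq_mod_eq_0)
  show "Suc j mod k = Suc (j mod k)" using assms by (metis dvd_eq_mod_eq_0 mod_Suc)
qed

text \<open>Partial sums are the right invariant: after an ascent the count ending in
  \<open>y\<close> is the partial sum below \<open>y\<close>, so binomials accumulate by the
  hockey-stick identity. At a block boundary the entry resets to 0 and the total becomes a new
  factor.\<close>

lemma sum_codes_ending_132:
  assumes "0 < k" "y \<le> j"
  shows "(\<Sum>x\<le>y. codes_ending (\<lambda>j x y. if k dvd j then y = 0 else x < y) (Suc j) x) =
    (\<Prod>i<j div k. (i * k + k - 1) choose (k - 1)) * (y choose (j mod k))"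
  using assms(2)
proof (induction j arbitrary: y)
  case 0
  then show ?case using codes_ending_1 by simp
next
  case (Suc j)
  let ?R = "\<lambda>j x y. if k dvd j then y = 0 else x < y"
  let ?Q = "\<lambda>j. \<Prod>i<j div k. (i * k + k - 1) choose (k - 1)"
  show ?case
  proof (cases "k dvd Suc j")
    case True
    note idx = block_index_Suc[OF True assms(1)]
    have "codes_ending ?R (Suc (Suc j)) x = (if x = 0 then \<Sum>z\<le>j. codes_ending ?R (Suc j) z else 0)"
      if "x \<le> Suc j" for x
      using that True by (simp add: codes_ending_Suc less_Suc_eq_le atMost_def)
    then have "(\<Sum>x\<le>y. codes_ending ?R (Suc (Suc j)) x) = (\<Sum>z\<le>j. codes_ending ?R (Suc j) z)"
      using Suc.prems by (simp add: sum.delta)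
    also have "\<dots> = ?Q j * (j choose (j mod k))"
      using Suc.IH by simp
    also have "\<dots> = ?Q (Suc j) * (y choose (Suc j mod k))"
    proof -
      have "j mod k = k - 1" using idx(1) by simp
      moreover have "j = j div k * k + k - 1" using idx(4) by (simp add: algebra_simps)
      ultimately show ?thesis unfolding idx(2,3) by simp
    qed
    finally show ?thesis .
  next
    case False
    note idx = block_index_Suc'[OF False]
    have *: "codes_ending ?R (Suc (Suc j)) (Suc x) = ?Q j * (x choose (j mod k))"
      if "x \<le> j" for x
    proof -
      have "{z. z < Suc j \<and> z < Suc x} = {..x}" using that by auto
      then show ?thesis using that False Suc.IH by (simp add: codes_ending_Suc)
    qed
    have "codes_ending ?R (Suc (Suc j)) 0 = 0" using False by (simp add: codes_ending_Suc)
    then show ?thesis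
    proof (cases y)
      case (Suc y')
      have "(\<Sum>x\<le>y. codes_ending ?R (Suc (Suc j)) x) = (\<Sum>x\<le>y'. ?Q j * (x choose (j mod k)))"
        unfolding Suc sum.atMost_Suc_shift using * Suc \<open>y \<le> Suc j\<close> \<open>codes_ending ?R (Suc (Suc j)) 0 = 0\<close>
        by (auto intro!: sum.cong)
      then show ?thesis
        using idx by (simp add: Suc sum_choose_upper flip: sum_distrib_left)
    qed (use idx in simp)
  qed
qed

lemma card_codes_132:
  assumes "0 < k"
  shows "card (codes (\<lambda>j x y. if k dvd j then y = 0 else x < y) (Suc j)) =
    (\<Prod>i<j div k. (i * k + k - 1) choose (k - 1)) * (j choose (j mod k))"
  using sum_codes_ending_132[OF assms, of j j] by (simp add: card_codes lessThan_Suc_atMost)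

text \<open>By absorption, the factor \<open>i + 1\<close> of the factorial turns the lower index
  \<open>k - 1\<close> into \<open>k\<close>.\<close>

lemma fact_times_prod_choose:
  assumes "0 < k"
  shows "fact m * (\<Prod>i<m. (i * k + k - 1) choose (k - 1)) = (\<Prod>i<m. (i * k + k) choose k)"
proof (induction m)
  case (Suc m)
  obtain k' where k: "k = Suc k'" using assms by (cases k) auto
  have "k * (Suc m * ((m * k + k - 1) choose (k - 1))) = k * ((m * k + k) choose k)"
    using Suc_times_binomial[of k' "m * k + k'"] by (simp add: k algebra_simps)
  then have *: "Suc m * ((m * k + k - 1) choose (k - 1)) = (m * k + k) choose k"
    using assms by simp
  show ?case
    unfolding prod.lessThan_Suc Suc.IH[symmetric] *[symmetric] by (simp add: algebra_simps)
qed simp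

text \<open>Both sides are the multinomial coefficient for splitting \<open>m * k + t\<close>
  elements into \<open>m\<close> sets of size \<open>k\<close> and one of size \<open>t\<close>,
  with the last set chosen at opposite ends of the process.\<close>

lemma prod_choose_times_choose:
  "(\<Prod>i<m. (i * k + k) choose k) * ((m * k + t) choose t) = (\<Prod>j = 1..m. (t + j * k) choose k)"
proof (induction m)
  case (Suc m)
  let ?n = "m * k + k + t"
  have "(?n choose (m * k + k)) * ((m * k + k) choose k) = (?n choose k) * ((?n - k) choose (m * k + k - k))"
    by (rule choose_mult) auto
  moreover have "?n choose (m * k + k) = ?n choose t"
    by (subst binomial_symmetric) auto
  moreover have "(?n - k) choose (m * k + k - k) = (m * k + t) choose t"
    by (subst binomial_symmetric) auto
  ultimately have *: "((m * k + k) choose k) * ((Suc m * k + t) choose t) =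
      ((t + Suc m * k) choose k) * ((m * k + t) choose t)"
    by (simp add: algebra_simps)
  have "(\<Prod>i<Suc m. (i * k + k) choose k) * ((Suc m * k + t) choose t) =
      (\<Prod>i<m. (i * k + k) choose k) * (((m * k + k) choose k) * ((Suc m * k + t) choose t))"
    by simp
  also have "\<dots> = ((t + Suc m * k) choose k) * ((\<Prod>i<m. (i * k + k) choose k) * ((m * k + t) choose t))"
    unfolding * by (simp only: ac_simps)
  finally show ?case
    unfolding Suc.IH by simp
qed simp

lemma card_codes_213:
  assumes "0 < k" "1 \<le> s" "s \<le> k"
  shows "card (codes (\<lambda>j x y. if k dvd j then y \<le> x else y = Suc x) (m * k + s)) = raney k m k"
proof -
  \<comment> \<open>Entries rise by one inside a block, so \<open>x + (k - (j - 1) mod k)\<close> is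
    constant there: it is one more than the entry at the end of a full block. The other index is the
    number of boundaries still ahead.\<close>
  define W where "W j x = raney k (m - (j - 1) div k) (x + (k - (j - 1) mod k))" for j x
  have "card (codes (\<lambda>j x y. if k dvd j then y \<le> x else y = Suc x) (m * k + s)) = W 1 0"
  proof (rule card_codes_backward)
    show "1 \<le> m * k + s" using assms by simp
    have "(m * k + s - 1) div k = m"
      using assms by (intro div_nat_eqI) (simp_all add: mult.commute)
    then show "W (m * k + s) x = 1" for x by (simp add: W_def)
  next
    fix j x assume j: "1 \<le> j" "j < m * k + s" and "x < j"
    obtain j' where j': "j = Suc j'" using j by (cases j) auto
    show "W j x = (\<Sum>y | y \<le> j \<and> (if k dvd j then y \<le> x else y = Suc x). W (Suc j) y)"
    proof (cases "k dvd j")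
      case True
      note idx = block_index_Suc[OF True[unfolded j'] assms(1)]
      have "Suc j' < k * Suc m"
        using j assms(3) unfolding j' by (simp add: algebra_simps)
      then have "k * Suc (j' div k) < k * Suc m"
        unfolding idx(4) .
      then have "j' div k < m" by simp
      then have n: "m - j' div k = Suc (m - Suc j' div k)" using idx(3) by simp
      have "{y. y \<le> j \<and> y \<le> x} = {..x}" using \<open>x < j\<close> by auto
      then have "(\<Sum>y | y \<le> j \<and> y \<le> x. W (Suc j) y) = (\<Sum>y\<le>x. raney k (m - Suc j' div k) (y + k))"
        by (simp add: W_def j' idx(2))
      also have "\<dots> = W j x"
      proof -
        have "x + (k - j' mod k) = Suc x" using idx(1) by linarith
        then show ?thesis unfolding sum_raney_shift W_def j' diff_Suc_1 n by simp
      qed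
      finally show ?thesis using True by simp
    next
      case False
      note idx = block_index_Suc'[OF False[unfolded j']]
      have "j' mod k < k" using assms by simp
      then have "Suc x + (k - Suc (j' mod k)) = x + (k - j' mod k)"
        by (metis Suc_diff_Suc add_Suc add_Suc_right)
      then have "W (Suc j) (Suc x) = W j x"
        by (simp only: W_def j' diff_Suc_1 idx)
      moreover have "{y. y \<le> j \<and> y = Suc x} = {Suc x}" using \<open>x < j\<close> by auto
      ultimately show ?thesis using False by simp
    qed
  qed
  then show ?thesis by (simp add: W_def)
qed

text \<open>The number of codes for 231 whose last entry, in position \<open>j + 1\<close>, is \<open>d\<close> below its maximum \<open>j\<close>.\<close>

definition gap_count :: "nat \<Rightarrow> nat \<Rightarrow> nat \<Rightarrow> nat" where
  "gap_count k j d = (if d \<le> j div k then raney k (j div k - d) (j mod k + (k - 1) * d) else 0)"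

lemma sum_gap_count:
  assumes "0 < k"
  shows "(\<Sum>d = c..j. gap_count k j d) =
    (if c \<le> j div k then raney k (j div k - c) (Suc (j mod k) + (k - 1) * c) else 0)"
proof -
  have "(\<Sum>d = c..j. gap_count k j d) = (\<Sum>d = c..j div k. gap_count k j d)"
    by (intro sum.mono_neutral_right) (auto simp: gap_count_def intro: order_trans)
  also have "\<dots> = (\<Sum>d = c..j div k. raney k (j div k - d) (j mod k + (k - 1) * d))"
    by (intro sum.cong) (auto simp: gap_count_def)
  finally show ?thesis
    using sum_raney_diagonal[of c "j div k" k "j mod k"] assms by simp
qed

text \<open>Measured by the gap below the maximum, an ascent to gap \<open>d\<close> sums over all
  previous gaps at least \<open>d\<close>, while a descent keeps the entry and raises the gap by
  one.\<close>

lemma codes_ending_231: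
  assumes "0 < k" "y \<le> j"
  shows "codes_ending (\<lambda>j x y. if k dvd j then y = x else x < y) (Suc j) y = gap_count k j (j - y)"
  using assms(2)
proof (induction j arbitrary: y)
  case 0
  then show ?case using codes_ending_1 by (simp add: gap_count_def)
next
  case (Suc j)
  let ?R = "\<lambda>j x y. if k dvd j then y = x else x < y"
  show ?case
  proof (cases "k dvd Suc j")
    case True
    note idx = block_index_Suc[OF True assms(1)]
    show ?thesis
    proof (cases "y \<le> j")
      case y: True
      then have "{x. x < Suc j \<and> y = x} = {y}" by auto
      then have "codes_ending ?R (Suc (Suc j)) y = gap_count k j (j - y)"
        using True Suc by (simp add: codes_ending_Suc y)
      also have "j mod k = k - 1" using idx(1) by simp
      then have "gap_count k j (j - y) = gap_count k (Suc j) (Suc (j - y))"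
        unfolding gap_count_def idx(2,3) by simp
      finally show ?thesis using y by (simp add: Suc_diff_le)
    next
      case False
      \<comment> \<open>The maximal entry cannot follow a descent; this matches
        \<open>raney k (Suc n) 0 = 0\<close>.\<close>
      then have "y = Suc j" using Suc.prems by simp
      moreover have "{x. x < Suc j \<and> Suc j = x} = {}" by auto
      ultimately show ?thesis using True idx by (simp add: codes_ending_Suc gap_count_def)
    qed
  next
    case False
    note idx = block_index_Suc'[OF False]
    have "{x. x < Suc j \<and> x < y} = {..<y}" using Suc.prems by auto
    then have "codes_ending ?R (Suc (Suc j)) y = (\<Sum>x<y. gap_count k j (j - x))"
      using False Suc by (simp add: codes_ending_Suc)
    also have "\<dots> = (\<Sum>d = Suc j - y..j. gap_count k j d)"
      using Suc.prems by (intro sum.reindex_bij_witness[where i = "\<lambda>d. j - d" and j = "\<lambda>x. j - x"]) auto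
    also have "\<dots> = gap_count k (Suc j) (Suc j - y)"
      by (simp add: sum_gap_count[OF assms(1)]) (simp add: gap_count_def idx)
    finally show ?thesis .
  qed
qed

lemma card_codes_231:
  assumes "0 < k"
  shows "card (codes (\<lambda>j x y. if k dvd j then y = x else x < y) (Suc j)) =
    raney k (j div k) (Suc (j mod k))"
proof -
  have "card (codes (\<lambda>j x y. if k dvd j then y = x else x < y) (Suc j)) = (\<Sum>y\<le>j. gap_count k j (j - y))"
    using assms by (simp add: card_codes lessThan_Suc_atMost codes_ending_231)
  also have "\<dots> = (\<Sum>d = 0..j. gap_count k j d)"
    by (intro sum.reindex_bij_witness[where i = "\<lambda>d. j - d" and j = "\<lambda>x. j - x"]) auto
  finally show ?thesis by (simp add: sum_gap_count assms)
qed

text \<open>Inside a block every entry is forced to its maximum. Choices occur only at a boundary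
  \<open>j = k * i\<close>, where the preceding entry is \<open>j - 1\<close> and leaves
  \<open>j\<close> options, giving the factor \<open>k * i\<close>.\<close>

lemma card_codes_312:
  assumes "2 \<le> k"
  shows "card (codes (\<lambda>j x y. if k dvd j then y \<le> x else y = j) (Suc j)) = k ^ (j div k) * fact (j div k)"
proof -
  let ?R = "\<lambda>j x y. if k dvd j then y \<le> x else y = j"
  \<comment> \<open>The number of codes of length \<open>Suc j\<close> ending in \<open>y\<close>:
    uniform on \<open>y < j\<close> when \<open>Suc j\<close> opens a block after the first,
    otherwise concentrated on \<open>y = j\<close>.\<close>
  let ?F = "\<lambda>j y. if 0 < j \<and> k dvd j then if y < j then k ^ (j div k - 1) * fact (j div k - 1) else 0
    else if y = j then k ^ (j div k) * fact (j div k) else 0"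
  have total: "(\<Sum>y\<le>j. ?F j y) = k ^ (j div k) * fact (j div k)" for j
  proof (cases "0 < j \<and> k dvd j")
    case True
    then obtain i where i: "j = k * i" by blast
    with True obtain i' where i': "i = Suc i'" by (cases i) auto
    have "(\<Sum>y\<le>j. ?F j y) = (\<Sum>y<j. k ^ i' * fact i')"
      using True assms(1) by (intro sum.mono_neutral_cong_right) (auto simp: i i')
    then show ?thesis using assms(1) by (simp add: i i' algebra_simps)
  qed auto
  have *: "codes_ending ?R (Suc j) y = ?F j y" if "y \<le> j" for j y
    using that
  proof (induction j arbitrary: y)
    case 0
    then show ?case using codes_ending_1 by simp
  next
    case (Suc j)
    show ?case
    proof (cases "k dvd Suc j")
      case True
      note idx = block_index_Suc[OF True]
      \<comment> \<open>As \<open>k\<close> is at least 2, the last position of a block is not its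
        first, so its entry is the forced maximum.\<close>
      have "\<not> (0 < j \<and> k dvd j)"
        using True assms(1) by (metis One_nat_def Suc_eq_plus1 Suc_n_not_le_n dvd_add_right_iff nat_dvd_1_iff_1 numeral_2_eq_2)
      then have F: "?F j x = (if x = j then k ^ (j div k) * fact (j div k) else 0)" for x
        by auto
      have "codes_ending ?R (Suc (Suc j)) y = (\<Sum>x | x < Suc j \<and> y \<le> x. codes_ending ?R (Suc j) x)"
        using True Suc.prems by (simp add: codes_ending_Suc)
      also have "\<dots> = (\<Sum>x | x < Suc j \<and> y \<le> x. if x = j then k ^ (j div k) * fact (j div k) else 0)"
        using Suc.IH unfolding F by (intro sum.cong) auto
      also have "\<dots> = (if y \<le> j then k ^ (j div k) * fact (j div k) else 0)"
        by (subst sum.delta) auto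
      finally show ?thesis using True idx(3) assms(1) by (simp add: less_Suc_eq_le)
    next
      case False
      have "codes_ending ?R (Suc (Suc j)) y = (if y = Suc j then \<Sum>x\<le>j. ?F j x else 0)"
        using False Suc by (simp add: codes_ending_Suc less_Suc_eq_le atMost_def)
      then show ?thesis using False total[of j] block_index_Suc'[OF False] by simp
    qed
  qed
  show ?thesis
    using total[of j] by (simp add: card_codes lessThan_Suc_atMost *)
qed

theorem theorem5p8:
  fixes k m s N :: nat
  assumes "k \<ge> 2" and "1 \<le> s" and "s \<le> k" and "N = m * k + s"
  shows "(k \<ge> 3 \<and> N \<ge> 3 \<longrightarrow> card (avoiders N k [1, 2, 3]) = 0) \<and>
    (\<not> (k \<ge> 3 \<and> N \<ge> 3) \<longrightarrow> card (avoiders N k [1, 2, 3]) = LE {1..N} (poset_123 m s k)) \<and>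
    real (card (avoiders N k [1, 3, 2])) =
      1 / fact m * (\<Prod>j = 1..m. real ((s + j * k - 1) choose k)) \<and>
    real (card (avoiders N k [2, 1, 3])) =
      1 / real ((k - 1) * (m + 1) + 1) * real ((k * (m + 1)) choose (m + 1)) \<and>
    real (card (avoiders N k [2, 3, 1])) =
      real s / real (m * k + s) * real ((m * k + s) choose m) \<and>
    card (avoiders N k [3, 1, 2]) = k ^ m * fact m \<and>
    card (avoiders N k [3, 2, 1]) = LE {1..N} (poset_321 m s k)"
proof -
  have k: "0 < k" using assms by simp
  obtain t where t: "s = Suc t" using assms(2) by (cases s) auto
  \<comment> \<open>The counts are indexed by the last position minus one; with
    \<open>t = s - 1 < k\<close> the quotient is \<open>m\<close> even when
    \<open>s = k\<close>.\<close>
  define M where "M = m * k + t"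
  have N: "N = Suc M" by (simp add: assms(4) t M_def)
  have idx: "M div k = m" "M mod k = t"
    using assms(3) by (simp_all add: M_def t)

  have "(\<Prod>j = 1..m. (s + j * k - 1) choose k) =
      (\<Prod>i<m. (i * k + k) choose k) * ((m * k + t) choose t)"
    by (simp add: prod_choose_times_choose t)
  also have "\<dots> = fact m * card (avoiders N k [1, 3, 2])"
    unfolding card_avoiders_132[OF k] N card_codes_132[OF k] idx fact_times_prod_choose[OF k, symmetric]
    by (simp add: M_def)
  finally have "fact m * card (avoiders N k [1, 3, 2]) = (\<Prod>j = 1..m. (s + j * k - 1) choose k)" ..
  then have "fact m * real (card (avoiders N k [1, 3, 2])) = (\<Prod>j = 1..m. real ((s + j * k - 1) choose k))"
    by (metis of_nat_fact of_nat_mult of_nat_prod)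
  then have p132: "real (card (avoiders N k [1, 3, 2])) =
      1 / fact m * (\<Prod>j = 1..m. real ((s + j * k - 1) choose k))"
    by (simp add: field_simps)

  have p213: "real (card (avoiders N k [2, 1, 3])) =
      1 / real ((k - 1) * (m + 1) + 1) * real ((k * (m + 1)) choose (m + 1))"
  proof -
    let ?n = "k * (m + 1)"
    \<comment> \<open>The closed form at \<open>a = k\<close> has lower index \<open>m\<close>;
      absorption raises it to \<open>m + 1\<close> and produces the denominator.\<close>
    have "?n - m = (k - 1) * (m + 1) + 1" using k by (cases k) simp_all
    moreover have "Suc m * (?n choose Suc m) = (?n - m) * (?n choose m)"
      by (metis binomial_absorb_comp binomial_absorption)
    moreover have "k * (Suc m * raney k m k) = k * (?n choose m)"
      using raney_closed_form[OF k, of k m] by (simp add: algebra_simps)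
    then have "Suc m * raney k m k = ?n choose m"
      unfolding nat_mult_eq_cancel1[OF k] .
    ultimately have "Suc m * (?n choose Suc m) = Suc m * (((k - 1) * (m + 1) + 1) * raney k m k)"
      by (metis mult.left_commute)
    then have "?n choose (m + 1) = ((k - 1) * (m + 1) + 1) * raney k m k"
      by (simp only: mult_cancel1) simp
    moreover have "card (avoiders N k [2, 1, 3]) = raney k m k"
      unfolding card_avoiders_213[OF k] using card_codes_213[OF k assms(2,3)] assms(4) by simp
    moreover have "x = 1 / real (Suc q) * (real (Suc q) * x)" for x q
      by simp
    ultimately show ?thesis
      by (metis Suc_eq_plus1 of_nat_mult)
  qed

  have "card (avoiders N k [2, 3, 1]) = raney k m s"
    unfolding card_avoiders_231[OF k] N card_codes_231[OF k] idx t ..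
  then have "N * card (avoiders N k [2, 3, 1]) = s * (N choose m)"
    using raney_closed_form[OF k, of s m] by (simp add: assms(4) ac_simps)
  then have "real N * real (card (avoiders N k [2, 3, 1])) = real s * real (N choose m)"
    by (metis of_nat_mult)
  then have p231: "real (card (avoiders N k [2, 3, 1])) =
      real s / real (m * k + s) * real ((m * k + s) choose m)"
    unfolding assms(4)[symmetric] by (simp add: N field_simps)

  have p312: "card (avoiders N k [3, 1, 2]) = k ^ m * fact m"
    unfolding card_avoiders_312[OF k] N card_codes_312[OF assms(1)] idx ..

  show ?thesis
    using p132 p213 p231 p312 avoiders_123_empty[of k N]
      card_avoiders_123[OF assms(2,3), of m] card_avoiders_321[OF assms(2,3), of m]
    unfolding assms(4)[symmetric] by simp
qed

end
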